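(* Let $X$ be a real Banach space with the super alternative Daugavet property. Then $(B_X,w)$ fails to have a countable $\pi$-base. In particular, $X$ contains an isomorphic copy of $\ell_1$.
   Context: $B_X$ and $S_X$ are the closed unit ball and the unit sphere of $X$, and $(B_X,w)$ is $B_X$ with the relative weak topology. An infinite-dimensional real Banach space $X$ has the super alternative Daugavet property if for every $x\in S_X$ and every non-empty relatively weakly open subset $W$ of $B_X$, $\sup_{y\in W}\max_{\theta\in\{-1,1\}}\|x+\theta y\|=2$. A $\pi$-base of a topological space $(E,\tau)$ is a collection $\{V_i\}_{i\in I}$ of non-empty open subsets of $E$ such that every non-empty open subset of $E$ contains one of the sets $V_i$. *)

theory Defs
  imports "HOL-Analysis.Analysis"
begin

definition weak_topology :: "'a::real_normed_vector topology" where
  "weak_topology =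
     topology_generated_by {blinfun_apply f -` U | (f :: 'a \<Rightarrow>\<^sub>L real) U. open U}"

definition weak_unit_ball :: "'a::real_normed_vector topology" where
  "weak_unit_ball = subtopology weak_topology (cball 0 1)"

definition pi_base :: "'a topology \<Rightarrow> 'a set set \<Rightarrow> bool" where
  "pi_base T \<V> \<longleftrightarrow>
     (\<forall>V\<in>\<V>. openin T V \<and> V \<noteq> {}) \<and>
     (\<forall>U. openin T U \<and> U \<noteq> {} \<longrightarrow> (\<exists>V\<in>\<V>. V \<subseteq> U))"

definition infinite_dimensional :: "'a::real_vector itself \<Rightarrow> bool" where
  "infinite_dimensional _ \<longleftrightarrow> \<not> (\<exists>B :: 'a set. finite B \<and> span B = UNIV)"

text \<open>The real supremum below is over a non-empty set bounded above by 2, so it is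
  never one of the unspecified values of \<open>Sup\<close>.\<close>

definition super_alternative_Daugavet :: "'a::banach itself \<Rightarrow> bool" where
  "super_alternative_Daugavet _ \<longleftrightarrow>
     infinite_dimensional TYPE('a) \<and>
     (\<forall>x \<in> sphere (0::'a) 1. \<forall>W. openin weak_unit_ball W \<and> W \<noteq> {} \<longrightarrow>
        (SUP y\<in>W. MAX \<theta>\<in>{-1, 1}. norm (x + \<theta> *\<^sub>R y)) = 2)"

text \<open>The real sequence space \<open>\<ell>\<^sub>1\<close> with its usual norm.\<close>

typedef ell1 = "{a :: nat \<Rightarrow> real. summable (\<lambda>n. \<bar>a n\<bar>)}"
  morphisms ell1_nth Abs_ell1
  by (rule exI[of _ "\<lambda>_. 0"]) simp

setup_lifting type_definition_ell1

lemma summable_ell1: "summable (\<lambda>n. \<bar>ell1_nth a n\<bar>)"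
  using ell1_nth by blast

instantiation ell1 :: real_normed_vector
begin

lift_definition zero_ell1 :: ell1 is "\<lambda>_. 0" by simp

lift_definition plus_ell1 :: "ell1 \<Rightarrow> ell1 \<Rightarrow> ell1" is "\<lambda>a b n. a n + b n"
  subgoal premises s for a b
    by (rule summable_comparison_test'[OF summable_add[OF s]]) auto
  done

lift_definition uminus_ell1 :: "ell1 \<Rightarrow> ell1" is "\<lambda>a n. - a n" by simp

lift_definition minus_ell1 :: "ell1 \<Rightarrow> ell1 \<Rightarrow> ell1" is "\<lambda>a b n. a n - b n"
  subgoal premises s for a b
    by (rule summable_comparison_test'[OF summable_add[OF s]]) auto
  done

lift_definition scaleR_ell1 :: "real \<Rightarrow> ell1 \<Rightarrow> ell1" is "\<lambda>r a n. r * a n"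
  by (simp add: abs_mult summable_mult)

lift_definition norm_ell1 :: "ell1 \<Rightarrow> real" is "\<lambda>a. \<Sum>n. \<bar>a n\<bar>" .

definition dist_ell1 :: "ell1 \<Rightarrow> ell1 \<Rightarrow> real" where
  "dist_ell1 a b = norm (a - b)"

definition sgn_ell1 :: "ell1 \<Rightarrow> ell1" where
  "sgn_ell1 a = inverse (norm a) *\<^sub>R a"

definition uniformity_ell1 :: "(ell1 \<times> ell1) filter" where
  "uniformity_ell1 = (INF e\<in>{0<..}. principal {(a, b). dist a b < e})"

definition open_ell1 :: "ell1 set \<Rightarrow> bool" where
  "open_ell1 U \<longleftrightarrow>
     (\<forall>a\<in>U. \<forall>\<^sub>F (a', b) in uniformity. a' = a \<longrightarrow> b \<in> U)"

instance
proof
  fix a b :: ell1 and r s :: real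
  show "norm a = 0 \<longleftrightarrow> a = 0"
    by transfer (auto simp: suminf_eq_zero_iff)
  show "norm (a + b) \<le> norm a + norm b"
  proof transfer
    fix a b :: "nat \<Rightarrow> real"
    assume s: "summable (\<lambda>n. \<bar>a n\<bar>)" "summable (\<lambda>n. \<bar>b n\<bar>)"
    have t: "summable (\<lambda>n. \<bar>a n + b n\<bar>)"
      by (rule summable_comparison_test'[OF summable_add[OF s]]) auto
    have "(\<Sum>n. \<bar>a n + b n\<bar>) \<le> (\<Sum>n. \<bar>a n\<bar> + \<bar>b n\<bar>)"
      by (rule suminf_le[OF abs_triangle_ineq t summable_add[OF s]])
    then show "(\<Sum>n. \<bar>a n + b n\<bar>) \<le> (\<Sum>n. \<bar>a n\<bar>) + (\<Sum>n. \<bar>b n\<bar>)"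
      by (simp add: suminf_add[OF s])
  qed
  show "norm (r *\<^sub>R a) = \<bar>r\<bar> * norm a"
    by transfer (simp add: abs_mult suminf_mult)
  show "a + b + c = a + (b + c)" for c
    by transfer (simp add: add.assoc)
  show "a + b = b + a"
    by transfer (simp add: add.commute)
  show "0 + a = a"
    by transfer simp
  show "- a + a = 0"
    by transfer simp
  show "a - b = a + - b"
    by transfer simp
  show "r *\<^sub>R (a + b) = r *\<^sub>R a + r *\<^sub>R b"
    by transfer (simp add: distrib_left)
  show "(r + s) *\<^sub>R a = r *\<^sub>R a + s *\<^sub>R a"
    by transfer (simp add: distrib_right)
  show "r *\<^sub>R s *\<^sub>R a = (r * s) *\<^sub>R a"
    by transfer (simp add: mult.assoc)
  show "1 *\<^sub>R a = a"
    by transfer simp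
qed (simp_all only: dist_ell1_def sgn_ell1_def uniformity_ell1_def open_ell1_def)

end

definition contains_isomorphic_copy ::
    "'a::real_normed_vector itself \<Rightarrow> 'b::real_normed_vector itself \<Rightarrow> bool" where
  "contains_isomorphic_copy _ _ \<longleftrightarrow>
     (\<exists>(Y :: 'a set) (T :: 'b \<Rightarrow> 'a) S.
        subspace Y \<and> closed Y \<and> linear T \<and> homeomorphism UNIV Y T S)"

end

theory Submission
  imports Defs
begin

text \<open>Everything happens on slices of the dual unit ball \<open>B\<close>, that is, on the sets of functionals
  that almost norm a given non-zero vector. If \<open>\<parallel>x + \<theta> y\<parallel>\<close> is almost \<open>2\<close> for a unit vector \<open>x\<close>, a point
  \<open>y\<close> of the unit ball and a sign \<open>\<theta>\<close>, then a functional that almost norms \<open>x + \<theta> y\<close> almost norms both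
  \<open>x\<close> and \<open>\<theta> y\<close>. So a thin slice at \<open>x + \<theta> y\<close> lies in a given slice at \<open>x\<close>, and \<open>\<theta> y\<close> is
  almost \<open>1\<close> on it. The norm is weakly lower semicontinuous, hence the inequality
  \<open>\<parallel>x + \<theta> y\<parallel> > 2 - \<eta>\<close> is a weakly open condition on \<open>y\<close>, and finitely many slices can be
  treated by one \<open>y\<close> in a prescribed weakly open set \<open>W\<close>. This is \<open>large_on_subslices\<close>.

  A countable \<open>\<pi>\<close>-base \<open>V\<^sub>0, V\<^sub>1, \<dots>\<close> is impossible: a decreasing sequence of slices gives
  \<open>y\<^sub>n \<in> V\<^sub>n\<close>, and weak* compactness gives a single functional \<open>g \<in> B\<close> with \<open>\<bar>g y\<^sub>n\<bar> \<ge> 1/2\<close> for all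
  \<open>n\<close>. Then the slab \<open>{\<bar>g\<bar> < 1/2}\<close> contains no \<open>V\<^sub>n\<close>.

  For the copy of \<open>\<ell>\<^sub>1\<close> the aim is a sequence in the unit ball such that every finite pattern of
  ``small'' and ``at least \<open>1/5\<close>'' is realised by some \<open>g \<in> B\<close>; testing a combination against the
  pattern of its positive coefficients, and of its negative ones, gives the lower
  \<open>\<ell>\<^sub>1\<close>-estimate. Given the \<open>2\<^sup>n\<close> slices that belong to the patterns of length \<open>n\<close>, the next
  vector has to split each of them into a subslice where it is small and one where it is large.
  Two obstacles arise.

  First, a \<open>y\<close> that is small at one functional of a slice need not be small on a subslice. But each
  slice has a subslice on which the members of a given finite set oscillate little
  (\<open>subslice_small_oscillation\<close>), and by weak* compactness finitely many points \<open>y\<close> that are large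
  on subslices suffice to find, for every choice of one functional per slice, a \<open>y\<close> that is small at
  all of them (\<open>finite_set_of_small_values\<close>). Choosing the functionals in subslices on which this
  finite set oscillates little gives \<open>small_and_large_on_subslices\<close>.

  Secondly, the sign \<open>\<theta>\<close> for which \<open>\<theta> y\<close> is large depends on the slice. An average
  \<open>1/N \<Sum> b\<^sub>i y\<^sub>i\<close> of successive such points has a common sign: if \<open>b\<^sub>i\<close> is chosen by a weighted
  majority of the slices, where a slice loses half its weight whenever \<open>b\<^sub>i\<close> agrees with its sign,
  then the total weight decays like \<open>(3/4)\<^sup>N\<close>, and for large \<open>N\<close> every slice has agreed at least
  \<open>N/4\<close> times. This is \<open>small_and_positive_on_subslices\<close>.\<close>

section \<open>Norming functionals\<close>

definition sublinear :: "('a::real_vector \<Rightarrow> real) \<Rightarrow> bool" where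
  "sublinear p \<longleftrightarrow>
     (\<forall>x y. p (x + y) \<le> p x + p y) \<and> (\<forall>c x. 0 \<le> c \<longrightarrow> p (c *\<^sub>R x) = c * p x)"

text \<open>The largest sublinear functional below \<open>p\<close> whose value at \<open>- x\<close> is at most \<open>- p x\<close>. Tilting a
  sublinear functional in every direction leads to the linear ones, as in the Hahn--Banach theorem.\<close>

definition tilt :: "('a::real_vector \<Rightarrow> real) \<Rightarrow> 'a \<Rightarrow> 'a \<Rightarrow> real" where
  "tilt p x y = (INF t\<in>{0..}. p (y + t *\<^sub>R x) - t * p x)"

lemma sublinear_add: "sublinear p \<Longrightarrow> p (x + y) \<le> p x + p y"
  by (simp add: sublinear_def)

lemma sublinear_scaleR: "sublinear p \<Longrightarrow> 0 \<le> c \<Longrightarrow> p (c *\<^sub>R x) = c * p x"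
  by (simp add: sublinear_def)

lemma sublinear_zero: "sublinear p \<Longrightarrow> p 0 = 0"
  using sublinear_scaleR[of p 0 0] by simp

lemma sublinear_ge_minus: "sublinear p \<Longrightarrow> - p (- x) \<le> p x"
  using sublinear_add[of p x "- x"] by (simp add: sublinear_zero)

text \<open>One inequality yields positive homogeneity: the reverse one follows by scaling back.\<close>

lemma sublinearI:
  assumes add: "\<And>x y. p (x + y) \<le> p x + p y"
    and le: "\<And>c x. 0 < c \<Longrightarrow> p (c *\<^sub>R x) \<le> c * p x"
    and zero: "p 0 = 0"
  shows "sublinear p"
proof -
  have "p (c *\<^sub>R x) = c * p x" if c: "0 \<le> c" for c x
  proof (cases "c = 0")
    case False
    with c have c': "0 < c" by simp
    show ?thesis
    proof (rule antisym)
      have "p ((1 / c) *\<^sub>R (c *\<^sub>R x)) \<le> (1 / c) * p (c *\<^sub>R x)"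
        by (rule le) (use c' in simp)
      then show "c * p x \<le> p (c *\<^sub>R x)"
        using c' by (simp add: field_simps)
    qed (rule le[OF c'])
  qed (simp add: zero)
  with add show ?thesis
    by (simp add: sublinear_def)
qed

lemma sublinear_norm: "sublinear (norm :: 'a::real_normed_vector \<Rightarrow> real)"
  by (simp add: sublinear_def norm_triangle_ineq)

lemma tilt_le:
  assumes p: "sublinear p" and t: "0 \<le> t"
  shows "tilt p x y \<le> p (y + t *\<^sub>R x) - t * p x"
  unfolding tilt_def
proof (rule cINF_lower)
  show "bdd_below ((\<lambda>t. p (y + t *\<^sub>R x) - t * p x) ` {0..})"
  proof (rule bdd_belowI2)
    fix s :: real assume "s \<in> {0..}"
    then have "s * p x = p ((y + s *\<^sub>R x) + (- y))"
      using sublinear_scaleR[OF p, of s x] by simp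
    then show "- p (- y) \<le> p (y + s *\<^sub>R x) - s * p x"
      using sublinear_add[OF p, of "y + s *\<^sub>R x" "- y"] by linarith
  qed
qed (use t in simp)

lemma tilt_greatest:
  assumes "\<And>t. 0 \<le> t \<Longrightarrow> c \<le> p (y + t *\<^sub>R x) - t * p x"
  shows "c \<le> tilt p x y"
  unfolding tilt_def by (rule cINF_greatest) (use assms in auto)

lemma sublinear_tilt:
  assumes p: "sublinear p"
  shows "sublinear (tilt p x)"
proof -
  have sub: "tilt p x (y + z) \<le> tilt p x y + tilt p x z" for y z
  proof -
    have "tilt p x (y + z) - tilt p x z \<le> p (y + t *\<^sub>R x) - t * p x" if t: "0 \<le> t" for t
    proof -
      have "tilt p x (y + z) - (p (y + t *\<^sub>R x) - t * p x) \<le> p (z + s *\<^sub>R x) - s * p x"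
        if s: "0 \<le> s" for s
      proof -
        have "tilt p x (y + z) \<le> p ((y + z) + (t + s) *\<^sub>R x) - (t + s) * p x"
          using tilt_le[OF p, of "t + s"] s t by simp
        also have "(y + z) + (t + s) *\<^sub>R x = (y + t *\<^sub>R x) + (z + s *\<^sub>R x)"
          by (simp add: scaleR_add_left)
        finally show ?thesis
          using sublinear_add[OF p, of "y + t *\<^sub>R x" "z + s *\<^sub>R x"] by (simp add: distrib_right)
      qed
      then have "tilt p x (y + z) - (p (y + t *\<^sub>R x) - t * p x) \<le> tilt p x z"
        by (rule tilt_greatest)
      then show ?thesis by simp
    qed
    then have "tilt p x (y + z) - tilt p x z \<le> tilt p x y"
      by (rule tilt_greatest)
    then show ?thesis by simp
  qed
  have le: "tilt p x (c *\<^sub>R y) \<le> c * tilt p x y" if c: "0 < c" for c y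
  proof -
    have "tilt p x (c *\<^sub>R y) / c \<le> p (y + t *\<^sub>R x) - t * p x" if t: "0 \<le> t" for t
    proof -
      have "tilt p x (c *\<^sub>R y) \<le> p (c *\<^sub>R y + (c * t) *\<^sub>R x) - (c * t) * p x"
        using tilt_le[OF p, of "c * t"] c t by simp
      also have "c *\<^sub>R y + (c * t) *\<^sub>R x = c *\<^sub>R (y + t *\<^sub>R x)"
        by (simp add: scaleR_add_right)
      also have "p (c *\<^sub>R (y + t *\<^sub>R x)) = c * p (y + t *\<^sub>R x)"
        by (rule sublinear_scaleR[OF p]) (use c in simp)
      finally show ?thesis
        using c by (simp add: field_simps)
    qed
    then have "tilt p x (c *\<^sub>R y) / c \<le> tilt p x y"
      by (rule tilt_greatest)
    then show ?thesis using c by (simp add: field_simps)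
  qed
  have zero: "tilt p x 0 = 0"
  proof (rule antisym)
    show "tilt p x 0 \<le> 0"
      using tilt_le[OF p, of 0 x 0] by (simp add: sublinear_zero[OF p])
    show "0 \<le> tilt p x 0"
      by (rule tilt_greatest) (simp add: sublinear_scaleR[OF p])
  qed
  show ?thesis
    using sub le zero by (rule sublinearI)
qed

text \<open>Zorn's lemma applies because the pointwise infimum of a chain of sublinear functionals below \<open>q\<close> is
  sublinear; it is finite since \<open>p x \<ge> - q (- x)\<close> for every such \<open>p\<close>.\<close>

lemma exists_minimal_sublinear:
  assumes q: "sublinear q"
  obtains m where "sublinear m" "m \<le> q" "\<And>p. sublinear p \<Longrightarrow> p \<le> m \<Longrightarrow> p = m"
proof -
  define A where "A = {p. sublinear p \<and> p \<le> q}"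
  let ?P = "\<lambda>p p' :: 'a \<Rightarrow> real. p' \<le> p"
  have po: "partial_order_on A (relation_of ?P A)"
    by (rule partial_order_on_relation_ofI) auto
  have ub: "\<exists>u\<in>A. \<forall>a\<in>C. ?P a u" if C: "C \<in> Chains (relation_of ?P A)" for C
  proof (cases "C = {}")
    case True
    then show ?thesis using q by (auto simp: A_def)
  next
    case False
    have CA: "p \<in> A" if "p \<in> C" for p
      using C that by (auto simp: Chains_def relation_of_def)
    have sl: "sublinear p" if "p \<in> C" for p
      using CA[OF that] by (simp add: A_def)
    have ch: "p \<le> p' \<or> p' \<le> p" if "p \<in> C" "p' \<in> C" for p p'
      using C that by (auto simp: Chains_def relation_of_def)
    define u where "u = (\<lambda>x. INF p\<in>C. p x)"
    have bdd: "bdd_below ((\<lambda>p. p x) ` C)" for x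
    proof (rule bdd_belowI2)
      fix p assume "p \<in> C"
      then show "- q (- x) \<le> p x"
        using sublinear_ge_minus[OF sl, of p x] CA[of p] le_funD[of p q "- x"]
        by (auto simp: A_def)
    qed
    have low: "u x \<le> p x" if "p \<in> C" for p x
      unfolding u_def by (rule cINF_lower[OF bdd that])
    have great: "c \<le> u x" if "\<And>p. p \<in> C \<Longrightarrow> c \<le> p x" for c x
      unfolding u_def by (rule cINF_greatest[OF False that])
    have add: "u (x + y) \<le> u x + u y" for x y
    proof -
      have "u (x + y) - p' y \<le> p x" if p: "p \<in> C" and p': "p' \<in> C" for p p'
        using ch[OF p p']
      proof
        assume "p \<le> p'"
        then show ?thesis
          using low[OF p, of "x + y"] sublinear_add[OF sl[OF p], of x y] le_funD[of p p' y]
          by linarith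
      next
        assume "p' \<le> p"
        then show ?thesis
          using low[OF p', of "x + y"] sublinear_add[OF sl[OF p'], of x y] le_funD[of p' p x]
          by linarith
      qed
      then have "u (x + y) - p' y \<le> u x" if "p' \<in> C" for p'
        by (intro great) (use that in auto)
      then have "u (x + y) - u x \<le> u y"
        by (intro great) (auto simp: algebra_simps)
      then show ?thesis by simp
    qed
    have le: "u (c *\<^sub>R x) \<le> c * u x" if c: "0 < c" for c x
    proof -
      have "u (c *\<^sub>R x) / c \<le> u x"
      proof (rule great)
        fix p assume p: "p \<in> C"
        show "u (c *\<^sub>R x) / c \<le> p x"
          using low[OF p, of "c *\<^sub>R x"] c by (simp add: sublinear_scaleR[OF sl[OF p]] field_simps)
      qed
      then show ?thesis using c by (simp add: field_simps)
    qed
    have zero: "u 0 = 0"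
      using False by (simp add: u_def sublinear_zero[OF sl])
    have "sublinear u"
      using add le zero by (rule sublinearI)
    moreover have "u \<le> q"
    proof (rule le_funI)
      obtain p where p: "p \<in> C" using False by blast
      show "u x \<le> q x" for x
        using low[OF p, of x] CA[OF p] le_funD[of p q x] by (auto simp: A_def)
    qed
    ultimately show ?thesis
      using low by (auto simp: A_def le_fun_def)
  qed
  obtain m where "m \<in> A" "\<And>a. a \<in> A \<Longrightarrow> a \<le> m \<Longrightarrow> a = m"
    using predicate_Zorn[OF po ub] by blast
  then show ?thesis
    using that[of m] by (auto simp: A_def dest: order_trans)
qed

text \<open>A minimal \<open>m\<close> equals its tilts, so \<open>m (- x) \<le> - m x\<close> for all \<open>x\<close>. A sublinear functional that is odd
  is also superadditive, hence linear.\<close>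

lemma minimal_sublinear_imp_linear:
  assumes m: "sublinear m" and min: "\<And>p. sublinear p \<Longrightarrow> p \<le> m \<Longrightarrow> p = m"
  shows "linear m"
proof -
  have odd: "m (- x) = - m x" for x
  proof -
    have "tilt m x = m"
      by (rule min[OF sublinear_tilt[OF m]])
        (use tilt_le[OF m, of 0 x] in \<open>simp add: le_fun_def\<close>)
    then have "m (- x) \<le> - m x"
      using tilt_le[OF m, of 1 x "- x"] by (simp add: sublinear_zero[OF m])
    with sublinear_ge_minus[OF m, of "- x"] show ?thesis by simp
  qed
  show ?thesis
  proof (rule linearI)
    fix x y
    have "m (- x + - y) \<le> m (- x) + m (- y)"
      by (rule sublinear_add[OF m])
    then show "m (x + y) = m x + m y"
      using sublinear_add[OF m, of x y] odd[of "x + y"] by (simp add: odd)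
  next
    fix c :: real and x
    show "m (c *\<^sub>R x) = c *\<^sub>R m x"
    proof (cases "0 \<le> c")
      case False
      then have "m ((- c) *\<^sub>R x) = (- c) * m x"
        by (intro sublinear_scaleR[OF m]) simp
      then show ?thesis by (simp add: odd)
    qed (simp add: sublinear_scaleR[OF m])
  qed
qed

text \<open>Functionals are plain functions, so that the product topology of the function space is the weak*
  topology.\<close>

definition dual_ball :: "('a::real_normed_vector \<Rightarrow> real) set" where
  "dual_ball = {g. linear g \<and> (\<forall>x. \<bar>g x\<bar> \<le> norm x)}"

lemma dual_ball_linear: "g \<in> dual_ball \<Longrightarrow> linear g"
  and dual_ball_abs_le: "g \<in> dual_ball \<Longrightarrow> \<bar>g x\<bar> \<le> norm x"
  by (auto simp: dual_ball_def)

lemma dual_ball_le: "g \<in> dual_ball \<Longrightarrow> g x \<le> norm x"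
  using dual_ball_abs_le[of g x] by simp

text \<open>Tilting the norm towards \<open>x\<close> before passing to a minimal sublinear functional forces the value
  \<open>norm x\<close> at \<open>x\<close>.\<close>

lemma exists_norming_functional: "\<exists>g\<in>dual_ball. g x = norm x"
proof -
  obtain m where m: "sublinear m" "m \<le> tilt norm x" "\<And>p. sublinear p \<Longrightarrow> p \<le> m \<Longrightarrow> p = m"
    using exists_minimal_sublinear[OF sublinear_tilt[OF sublinear_norm]] by blast
  have lin: "linear m"
    by (rule minimal_sublinear_imp_linear[OF m(1,3)])
  have le: "m y \<le> norm y" for y
    using le_funD[OF m(2), of y] tilt_le[OF sublinear_norm, of 0 x y] by simp
  have abs: "\<bar>m y\<bar> \<le> norm y" for y
    using le[of y] le[of "- y"] by (simp add: linear_neg[OF lin] abs_le_iff)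
  have "m (- x) \<le> - norm x"
    using le_funD[OF m(2), of "- x"] tilt_le[OF sublinear_norm, of 1 x "- x"] by simp
  then have "m x = norm x"
    using le[of x] by (simp add: linear_neg[OF lin])
  then show ?thesis
    using lin abs by (auto simp: dual_ball_def)
qed

section \<open>Slices of the dual ball\<close>

definition slice :: "'a::real_normed_vector \<Rightarrow> real \<Rightarrow> ('a \<Rightarrow> real) set" where
  "slice x e = {g \<in> dual_ball. norm x - e < g x}"

definition slices :: "('a::real_normed_vector \<Rightarrow> real) set set" where
  "slices = {slice x e |x e. x \<noteq> 0 \<and> 0 < e}"

lemma slice_in_slices: "x \<noteq> 0 \<Longrightarrow> 0 < e \<Longrightarrow> slice x e \<in> slices"
  by (auto simp: slices_def)

lemma slices_subset_dual_ball: "C \<in> slices \<Longrightarrow> C \<subseteq> dual_ball"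
  by (auto simp: slices_def slice_def)

lemma slices_nonempty: "C \<in> slices \<Longrightarrow> C \<noteq> {}"
proof -
  assume "C \<in> slices"
  then obtain x e where C: "C = slice x e" "0 < e"
    by (auto simp: slices_def)
  obtain g where "g \<in> dual_ball" "g x = norm x"
    using exists_norming_functional by blast
  then have "g \<in> C" using C by (simp add: slice_def)
  then show ?thesis by blast
qed

text \<open>Slices at nearby vectors are comparable; the factor \<open>2\<close> pays for the change of the norm and for the
  change of the value of the functional.\<close>

lemma slice_perturb_subset:
  assumes "2 * norm z + e' \<le> e"
  shows "slice (x + z) e' \<subseteq> slice x e"
proof
  fix g assume "g \<in> slice (x + z) e'"
  then have g: "g \<in> dual_ball" and gt: "norm (x + z) - e' < g (x + z)"
    by (auto simp: slice_def)
  have "norm x - norm z \<le> norm (x + z)"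
    by (metis norm_diff_ineq)
  moreover have "g (x + z) = g x + g z"
    using dual_ball_linear[OF g] by (rule linear_add)
  moreover have "g z \<le> norm z"
    using g by (rule dual_ball_le)
  ultimately show "g \<in> slice x e"
    using g gt assms by (simp add: slice_def)
qed

text \<open>The value near which \<open>y\<close> is confined is the one-sided derivative \<open>D\<close> of the norm at \<open>x\<close> in
  direction \<open>y\<close>. On thin slices at \<open>x\<close> the difference quotient bounds \<open>g y\<close> from above by about
  \<open>D\<close>. On a thin slice at \<open>x + t y\<close>, with a small \<open>t > 0\<close>, it bounds \<open>g y\<close> from below by about
  \<open>D\<close>, and this slice is contained in the former one.\<close>

lemma subslice_near_value:
  fixes C :: "('a::real_normed_vector \<Rightarrow> real) set"
  assumes C: "C \<in> slices" and eta: "0 < \<eta>"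
  shows "\<exists>C'\<in>slices. C' \<subseteq> C \<and> (\<exists>r. \<forall>g\<in>C'. \<bar>g y - r\<bar> < \<eta>)"
proof -
  obtain x e where xe: "C = slice x e" "x \<noteq> 0" "0 < e"
    using C by (auto simp: slices_def)
  define q where "q t = (norm (x + t *\<^sub>R y) - norm x) / t" for t
  define D where "D = (INF t\<in>{0<..}. q t)"
  have bdd: "bdd_below (q ` {0<..})"
  proof (rule bdd_belowI2)
    fix t :: real assume "t \<in> {0<..}"
    then have t: "0 < t" by simp
    have "norm x - norm (t *\<^sub>R y) \<le> norm (x + t *\<^sub>R y)"
      by (rule norm_diff_ineq)
    then show "- norm y \<le> q t"
      using t by (simp add: q_def field_simps)
  qed
  have D_le: "D \<le> q t" if "0 < t" for t
    unfolding D_def by (rule cINF_lower[OF bdd]) (use that in simp)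
  have "\<exists>v\<in>q ` {0<..}. v < D + \<eta> / 2"
    unfolding D_def by (rule cInf_lessD) (use eta in auto)
  then obtain s where s: "0 < s" "q s < D + \<eta> / 2" by auto
  \<comment> \<open>On slices at \<open>x\<close> of width \<open>e1\<close>, the quotient at \<open>s\<close> already gives the upper bound.\<close>
  define e1 where "e1 = min e (s * \<eta> / 2)"
  have e1: "0 < e1" "e1 \<le> e" "e1 \<le> s * \<eta> / 2"
    using xe s eta by (auto simp: e1_def)
  define c where "c = norm y + 1"
  have c: "0 < c" "norm y \<le> c"
    by (simp_all add: c_def add_nonneg_pos)
  \<comment> \<open>So small that \<open>x + t y\<close> is not zero and that its thin slices lie in \<open>slice x e1\<close>.\<close>
  define t where "t = min e1 (norm x) / 4 / c"
  have t: "0 < t"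
    using e1 xe c by (simp add: t_def)
  have "t * norm y \<le> t * c"
    using t c by (simp add: mult_left_mono)
  also have "\<dots> = min e1 (norm x) / 4"
    using c by (simp add: t_def)
  finally have ty: "4 * norm (t *\<^sub>R y) \<le> min e1 (norm x)"
    using t by simp
  define e2 where "e2 = min (e1 / 2) (t * \<eta>)"
  have e2: "0 < e2" using e1 t eta by (simp add: e2_def)
  have ne: "x + t *\<^sub>R y \<noteq> 0"
  proof
    assume "x + t *\<^sub>R y = 0"
    then have "norm x = norm (t *\<^sub>R y)"
      by (metis add_eq_0_iff2 norm_minus_cancel)
    moreover have "0 < norm x" using xe(2) by simp
    ultimately show False using ty by linarith
  qed
  have "e2 \<le> e1 / 2" "min e1 (norm x) \<le> e1"
    unfolding e2_def by (rule min.cobounded1)+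
  with ty have "2 * norm (t *\<^sub>R y) + e2 \<le> e1"
    by linarith
  then have sub1: "slice (x + t *\<^sub>R y) e2 \<subseteq> slice x e1"
    by (rule slice_perturb_subset)
  have sub2: "slice x e1 \<subseteq> C"
    using slice_perturb_subset[of 0 e1 e x] e1 xe by simp
  have near: "\<bar>g y - D\<bar> < \<eta>" if g': "g \<in> slice (x + t *\<^sub>R y) e2" for g
  proof -
    have g: "g \<in> dual_ball" and gt: "norm (x + t *\<^sub>R y) - e2 < g (x + t *\<^sub>R y)"
      using g' by (auto simp: slice_def)
    have gx: "norm x - e1 < g x"
      using g' sub1 by (auto simp: slice_def)
    have lin: "g (x + r *\<^sub>R y) = g x + r * g y" for r
      using dual_ball_linear[OF g] by (simp add: linear_add linear_scale)
    have "s * g y < norm (x + s *\<^sub>R y) - norm x + e1"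
      using dual_ball_le[OF g, of "x + s *\<^sub>R y"] lin[of s] gx by simp
    also have "\<dots> \<le> s * q s + s * (\<eta> / 2)"
      using s e1 by (simp add: q_def)
    finally have "s * g y < s * (q s + \<eta> / 2)"
      by (simp add: distrib_left)
    then have "g y < q s + \<eta> / 2"
      using s(1) by simp
    then have up: "g y < D + \<eta>"
      using s(2) by simp
    have "t * q t - t * \<eta> < t * g y"
      using gt dual_ball_le[OF g, of x] lin[of t] t by (simp add: q_def e2_def)
    then have "t * (q t - \<eta>) < t * g y"
      by (simp add: right_diff_distrib)
    then have "q t - \<eta> < g y"
      using t by simp
    with D_le[OF t] up show ?thesis by (simp add: abs_less_iff)
  qed
  show ?thesis
    using slice_in_slices[OF ne e2] sub1 sub2 near by blast
qed

lemma subslice_small_oscillation: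
  fixes C :: "('a::real_normed_vector \<Rightarrow> real) set"
  assumes "finite F" "C \<in> slices" and eta: "0 < \<eta>"
  shows "\<exists>C'\<in>slices. C' \<subseteq> C \<and> (\<forall>y\<in>F. \<forall>g\<in>C'. \<forall>h\<in>C'. \<bar>g y - h y\<bar> < \<eta>)"
  using assms(1,2)
proof (induction F)
  case empty
  then show ?case by blast
next
  case (insert y F)
  then obtain C1 where C1: "C1 \<in> slices" "C1 \<subseteq> C"
      "\<forall>y\<in>F. \<forall>g\<in>C1. \<forall>h\<in>C1. \<bar>g y - h y\<bar> < \<eta>"
    by blast
  obtain C2 r where C2: "C2 \<in> slices" "C2 \<subseteq> C1" "\<forall>g\<in>C2. \<bar>g y - r\<bar> < \<eta> / 2"
    using subslice_near_value[OF C1(1), of "\<eta> / 2" y] eta by auto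
  have "\<bar>g y - h y\<bar> < \<eta>" if "g \<in> C2" "h \<in> C2" for g h
    using bspec[OF C2(3) that(1)] bspec[OF C2(3) that(2)] by linarith
  then show ?case
    using C1 C2 by (intro bexI[of _ C2]) blast+
qed

section \<open>Weakly open sets and the super alternative Daugavet property\<close>

lemma topspace_weak_unit_ball: "topspace weak_unit_ball = cball (0::'a::real_normed_vector) 1"
proof -
  have "UNIV \<in> {blinfun_apply f -` U | (f :: 'a \<Rightarrow>\<^sub>L real) U. open U}"
    by (auto intro!: exI[of _ "UNIV :: real set"])
  then have "topspace (weak_topology :: 'a topology) = UNIV"
    unfolding weak_topology_def topology_generated_by_topspace by blast
  then show ?thesis
    by (simp add: weak_unit_ball_def)
qed

lemma weakly_open_subset_ball: "openin weak_unit_ball W \<Longrightarrow> W \<subseteq> cball 0 1"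
  using openin_subset[of weak_unit_ball W] by (simp add: topspace_weak_unit_ball)

lemma openin_weak_preimage:
  assumes g: "g \<in> dual_ball" and U: "open U"
  shows "openin weak_unit_ball {y \<in> cball 0 1. g y \<in> U}"
proof -
  have "bounded_linear g"
    by (rule bounded_linear_intro[of g 1])
      (use dual_ball_linear[OF g] dual_ball_abs_le[OF g] in
        \<open>auto simp: linear_add linear_scale\<close>)
  then have "g -` U = blinfun_apply (Blinfun g) -` U"
    by (simp add: bounded_linear_Blinfun_apply)
  then have "openin weak_topology (g -` U)"
    unfolding weak_topology_def
    by (intro topology_generated_by_Basis) (use U in blast)
  then have "openin weak_unit_ball (cball 0 1 \<inter> g -` U)"
    unfolding weak_unit_ball_def by (simp add: openin_subtopology_Int2)
  moreover have "cball 0 1 \<inter> g -` U = {y \<in> cball 0 1. g y \<in> U}"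
    by auto
  ultimately show ?thesis by simp
qed

lemma openin_weak_slab:
  assumes J: "finite J" and h: "\<And>j. j \<in> J \<Longrightarrow> h j \<in> dual_ball"
  shows "openin weak_unit_ball {y \<in> cball 0 1. \<forall>j\<in>J. \<bar>h j y\<bar> < c}"
  using assms
proof (induction J)
  case empty
  have "openin weak_unit_ball (topspace weak_unit_ball)" by simp
  then show ?case by (simp add: topspace_weak_unit_ball cball_def)
next
  case (insert j J)
  have "openin weak_unit_ball {y \<in> cball 0 1. h j y \<in> {- c<..<c}}"
    by (rule openin_weak_preimage) (use insert in auto)
  moreover have "openin weak_unit_ball {y \<in> cball 0 1. \<forall>j\<in>J. \<bar>h j y\<bar> < c}"
    using insert by blast
  ultimately have "openin weak_unit_ball
      ({y \<in> cball 0 1. h j y \<in> {- c<..<c}} \<inter> {y \<in> cball 0 1. \<forall>j\<in>J. \<bar>h j y\<bar> < c})"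
    by (rule openin_Int)
  also have "{y \<in> cball 0 1. h j y \<in> {- c<..<c}} \<inter> {y \<in> cball 0 1. \<forall>j\<in>J. \<bar>h j y\<bar> < c} =
      {y \<in> cball 0 1. \<forall>i\<in>insert j J. \<bar>h i y\<bar> < c}"
    by (auto simp: abs_less_iff)
  finally show ?case .
qed

lemma far_point:
  assumes X: "super_alternative_Daugavet TYPE('a::banach)"
    and u: "norm (u :: 'a) = 1" and W: "openin weak_unit_ball W" "W \<noteq> {}" and eta: "0 < \<eta>"
  shows "\<exists>y\<in>W. \<exists>\<theta>\<in>{-1, 1}. 2 - \<eta> < norm (u + \<theta> *\<^sub>R y)"
proof (rule ccontr)
  assume "\<not> ?thesis"
  then have "(SUP y\<in>W. MAX \<theta>\<in>{-1, 1}. norm (u + \<theta> *\<^sub>R y)) \<le> 2 - \<eta>"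
    by (intro cSUP_least[OF W(2)]) (auto simp: not_less)
  moreover have "(SUP y\<in>W. MAX \<theta>\<in>{-1, 1}. norm (u + \<theta> *\<^sub>R y)) = 2"
    using X u W by (auto simp: super_alternative_Daugavet_def)
  ultimately show False using eta by simp
qed

text \<open>The vectors \<open>u\<close> are treated one after the other. Once \<open>\<parallel>u + \<theta> y0\<parallel>\<close> is large, so is
  \<open>\<parallel>u + \<theta> y\<parallel>\<close> for all \<open>y\<close> in a weakly open set around \<open>y0\<close>, by a functional that norms
  \<open>u + \<theta> y0\<close>; the next vectors only have to be treated within this set.\<close>

lemma far_point_finite:
  assumes X: "super_alternative_Daugavet TYPE('a::banach)"
    and "finite U" "U \<subseteq> sphere (0::'a) 1"
    and "openin weak_unit_ball W" "W \<noteq> {}" and eta: "0 < \<eta>"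
  shows "\<exists>y\<in>W. \<forall>u\<in>U. \<exists>\<theta>\<in>{-1, 1}. 2 - \<eta> < norm (u + \<theta> *\<^sub>R y)"
  using assms(2-5)
proof (induction U arbitrary: W)
  case empty
  then show ?case by auto
next
  case (insert u U)
  obtain y0 \<theta> where y0: "y0 \<in> W" and th: "\<theta> \<in> {-1, 1::real}" "2 - \<eta> < norm (u + \<theta> *\<^sub>R y0)"
    using far_point[OF X, of u W \<eta>] insert.prems eta by (simp del: bex_simps) blast
  obtain g where g: "g \<in> dual_ball" "g (u + \<theta> *\<^sub>R y0) = norm (u + \<theta> *\<^sub>R y0)"
    using exists_norming_functional by blast
  have lin: "g (u + \<theta> *\<^sub>R y) = g u + \<theta> * g y" for y
    using dual_ball_linear[OF g(1)] by (simp add: linear_add linear_scale)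
  define W' where "W' = W \<inter> {y \<in> cball 0 1. g y \<in> {r. 2 - \<eta> < g u + \<theta> * r}}"
  have "open {r. 2 - \<eta> < g u + \<theta> * r}"
    by (intro open_Collect_less continuous_intros)
  then have "openin weak_unit_ball W'"
    unfolding W'_def by (intro openin_Int insert.prems openin_weak_preimage g)
  moreover have "y0 \<in> W'"
    using y0 th(2) g(2) lin[of y0] weakly_open_subset_ball[OF insert.prems(2)]
    by (auto simp: W'_def)
  ultimately obtain y where y: "y \<in> W'"
      "\<forall>u\<in>U. \<exists>\<theta>\<in>{-1, 1}. 2 - \<eta> < norm (u + \<theta> *\<^sub>R y)"
    using insert by blast
  have "2 - \<eta> < norm (u + \<theta> *\<^sub>R y)"
    using y(1) dual_ball_le[OF g(1), of "u + \<theta> *\<^sub>R y"] lin[of y] by (auto simp: W'_def)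
  then show ?case
    using y th(1) by (intro bexI[of _ y]) (auto simp: W'_def)
qed

text \<open>The subslice of a slice at the unit vector \<open>u\<close> is a thin slice at \<open>u + \<theta> y\<close>, for a point \<open>y\<close> with
  \<open>\<parallel>u + \<theta> y\<parallel>\<close> close to \<open>2\<close>: there both \<open>g u\<close> and \<open>\<theta> g y\<close> are at most \<open>1\<close> and their sum is
  almost \<open>2\<close>.\<close>

lemma large_on_subslices:
  fixes C :: "'j \<Rightarrow> ('a::banach \<Rightarrow> real) set"
  assumes X: "super_alternative_Daugavet TYPE('a)"
    and J: "finite J" and C: "\<And>j. j \<in> J \<Longrightarrow> C j \<in> slices"
    and W: "openin weak_unit_ball W" "W \<noteq> {}" and eta: "0 < \<eta>"
  shows "\<exists>y\<in>W. \<forall>j\<in>J. \<exists>\<theta>\<in>{-1, 1}. \<exists>C'\<in>slices. C' \<subseteq> C j \<and> (\<forall>g\<in>C'. 1 - \<eta> < \<theta> * g y)"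
proof -
  have "\<forall>j\<in>J. \<exists>x e. C j = slice x e \<and> x \<noteq> 0 \<and> 0 < e"
    using C by (auto simp: slices_def)
  then obtain x e where xe: "\<And>j. j \<in> J \<Longrightarrow> C j = slice (x j) (e j) \<and> x j \<noteq> 0 \<and> 0 < e j"
    by metis
  define E where "E = insert (min 1 \<eta>) ((\<lambda>j. e j / norm (x j)) ` J)"
  define d where "d = Min E / 2"
  have E: "finite E" "E \<noteq> {}" "\<forall>r\<in>E. 0 < r"
    using J eta xe by (auto simp: E_def)
  have "0 < Min E"
    using E by (simp add: Min_gr_iff)
  then have d: "0 < d" by (simp add: d_def)
  have dE: "2 * d \<le> r" if "r \<in> E" for r
    using E that by (simp add: d_def)
  have d1: "2 * d \<le> 1" "2 * d \<le> \<eta>"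
    using dE[of "min 1 \<eta>"] by (auto simp: E_def)
  \<comment> \<open>As a slice at the unit vector \<open>u j\<close>, the set \<open>C j\<close> has width \<open>e j / norm (x j)\<close>.\<close>
  define u where "u j = x j /\<^sub>R norm (x j)" for j
  have u1: "norm (u j) = 1" if "j \<in> J" for j
    using xe[OF that] by (simp add: u_def)
  have "u ` J \<subseteq> sphere 0 1"
    using u1 by auto
  from far_point_finite[OF X finite_imageI[OF J] this W d]
  obtain y where y: "y \<in> W" "\<forall>v\<in>u ` J. \<exists>\<theta>\<in>{-1, 1}. 2 - d < norm (v + \<theta> *\<^sub>R y)"
    by blast
  have ny: "norm y \<le> 1"
    using y(1) weakly_open_subset_ball[OF W(1)] by auto
  have "\<exists>\<theta>\<in>{-1, 1}. \<exists>C'\<in>slices. C' \<subseteq> C j \<and> (\<forall>g\<in>C'. 1 - \<eta> < \<theta> * g y)" if j: "j \<in> J" for j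
  proof -
    obtain \<theta> where th: "\<theta> \<in> {-1, 1::real}" "2 - d < norm (u j + \<theta> *\<^sub>R y)"
      using y(2) j by blast
    let ?C = "slice (u j + \<theta> *\<^sub>R y) d"
    have "u j + \<theta> *\<^sub>R y \<noteq> 0"
      using th(2) d1 by auto
    then have 1: "?C \<in> slices"
      using d by (rule slice_in_slices)
    have 2: "1 - 2 * d < \<theta> * g y \<and> 1 - 2 * d < g (u j) \<and> g \<in> dual_ball" if "g \<in> ?C" for g
    proof -
      have g: "g \<in> dual_ball" "2 - 2 * d < g (u j + \<theta> *\<^sub>R y)"
        using that th(2) by (auto simp: slice_def)
      have "g (u j + \<theta> *\<^sub>R y) = g (u j) + \<theta> * g y"
        using dual_ball_linear[OF g(1)] by (simp add: linear_add linear_scale)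
      moreover have "g (u j) \<le> 1"
        using dual_ball_le[OF g(1), of "u j"] u1[OF j] by simp
      moreover have "\<theta> * g y \<le> 1"
        using dual_ball_abs_le[OF g(1), of y] ny th(1) by (auto simp: abs_le_iff)
      ultimately show ?thesis using g by linarith
    qed
    have "?C \<subseteq> C j"
    proof
      fix g assume "g \<in> ?C"
      note g = 2[OF this]
      have nx: "0 < norm (x j)" using xe[OF j] by simp
      have "2 * d \<le> e j / norm (x j)"
        by (rule dE) (use j in \<open>auto simp: E_def\<close>)
      then have "1 - e j / norm (x j) < g (u j)"
        using g by linarith
      also have "g (u j) = g (x j) / norm (x j)"
        using dual_ball_linear[of g] g by (simp add: u_def linear_scale divide_inverse mult.commute)
      finally have "norm (x j) - e j < g (x j)"
        using nx by (simp add: field_simps)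
      then show "g \<in> C j"
        using g xe[OF j] by (simp add: slice_def)
    qed
    moreover have "\<forall>g\<in>?C. 1 - \<eta> < \<theta> * g y"
    proof
      fix g assume "g \<in> ?C"
      then show "1 - \<eta> < \<theta> * g y" using 2[of g] d1 by linarith
    qed
    ultimately show ?thesis using th(1) 1 by blast
  qed
  then show ?thesis using y(1) by blast
qed

section \<open>Weak* compactness\<close>

lemma continuous_on_eval: "continuous_on UNIV (\<lambda>g :: 'b \<Rightarrow> real. g x)"
  by simp

lemma compact_Pi_UNIV:
  fixes K :: "'i \<Rightarrow> 'b::topological_space set"
  assumes "\<And>i. compact (K i)"
  shows "compact {f. \<forall>i. f i \<in> K i}"
proof -
  have "compactin (product_topology (\<lambda>i. euclidean) UNIV) (PiE UNIV K)"
    using assms by (simp add: compactin_PiE)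
  moreover have "PiE UNIV K = {f. \<forall>i. f i \<in> K i}"
    by (auto simp: PiE_def Pi_def)
  ultimately show ?thesis
    by (simp add: euclidean_product_topology compactin_euclidean_iff)
qed

text \<open>Alaoglu's theorem: linearity is a closed condition in a product of compact intervals.\<close>

lemma compact_dual_ball: "compact (dual_ball :: ('a::real_normed_vector \<Rightarrow> real) set)"
proof -
  let ?B = "{g :: 'a \<Rightarrow> real. \<forall>x. g x \<in> {- norm x..norm x}}"
  let ?A = "\<Inter>x. \<Inter>y. {g :: 'a \<Rightarrow> real. g (x + y) = g x + g y}"
  let ?S = "\<Inter>c. \<Inter>x. {g :: 'a \<Rightarrow> real. g (c *\<^sub>R x) = c * g x}"
  have "closed ?A" "closed ?S"
    by (intro closed_INT ballI closed_Collect_eq continuous_intros continuous_on_eval)+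
  moreover have "compact ?B"
    by (rule compact_Pi_UNIV) simp
  ultimately have "compact (?B \<inter> (?A \<inter> ?S))"
    by (intro compact_Int_closed closed_Int)
  moreover have "?B \<inter> (?A \<inter> ?S) = dual_ball"
    by (auto simp: dual_ball_def linear_iff abs_le_iff minus_le_iff)
  ultimately show ?thesis by simp
qed

section \<open>Failure of countable pi-bases\<close>

lemma exists_functional_large_on_sequence:
  fixes y :: "nat \<Rightarrow> 'a::real_normed_vector"
  assumes "\<And>n. \<exists>g\<in>dual_ball. \<forall>i<n. c \<le> \<bar>g (y i)\<bar>"
  shows "\<exists>g\<in>dual_ball. \<forall>i. c \<le> \<bar>g (y i)\<bar>"
proof -
  have "dual_ball \<inter> (\<Inter>i. {g. c \<le> \<bar>g (y i)\<bar>}) \<noteq> {}"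
  proof (rule compact_imp_fip_image[OF compact_dual_ball])
    fix I :: "nat set" assume "finite I"
    then obtain n where n: "I \<subseteq> {..<n}"
      using finite_nat_iff_bounded by blast
    then show "dual_ball \<inter> (\<Inter>i\<in>I. {g. c \<le> \<bar>g (y i)\<bar>}) \<noteq> {}"
      using assms[of n] by blast
  qed (intro closed_Collect_le continuous_intros continuous_on_eval)
  then show ?thesis
    by auto
qed

lemma exists_slice:
  assumes X: "super_alternative_Daugavet TYPE('a::banach)"
  shows "(slices :: ('a \<Rightarrow> real) set set) \<noteq> {}"
proof -
  obtain x :: 'a where "x \<noteq> 0"
  proof (rule ccontr)
    assume "\<not> thesis"
    then have "\<forall>x :: 'a. x = 0"
      using that by blast
    then have "span {} = (UNIV :: 'a set)" by auto
    then show False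
      using X unfolding super_alternative_Daugavet_def infinite_dimensional_def by blast
  qed
  then show ?thesis
    using slice_in_slices[of x 1] by auto
qed

text \<open>Since slices shrink along the construction, the functionals of the \<open>n\<close>-th slice are large at all of
  \<open>y 0, \<dots>, y (n - 1)\<close>. The slices are not weak* closed, so the limit only satisfies the weak
  inequality.\<close>

lemma exists_sequence_selection_norming:
  fixes V :: "nat \<Rightarrow> 'a::banach set"
  assumes X: "super_alternative_Daugavet TYPE('a)"
    and V: "\<And>n. openin weak_unit_ball (V n)" "\<And>n. V n \<noteq> {}"
  shows "\<exists>y. (\<forall>n. y n \<in> V n) \<and> (\<exists>g\<in>dual_ball. \<forall>n. 1 / 2 \<le> \<bar>g (y n)\<bar>)"
proof -
  let ?Q = "\<lambda>n (s :: 'a \<times> ('a \<Rightarrow> real) set) s'.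
      snd s' \<subseteq> snd s \<and> fst s' \<in> V n \<and> (\<forall>g\<in>snd s'. 1 / 2 < \<bar>g (fst s')\<bar>)"
  have "\<exists>s. \<forall>n. snd (s n) \<in> slices \<and> ?Q n (s n) (s (Suc n))"
  proof (rule dependent_nat_choice)
    show "\<exists>s :: 'a \<times> ('a \<Rightarrow> real) set. snd s \<in> slices"
      using exists_slice[OF X] by auto
  next
    fix s :: "'a \<times> ('a \<Rightarrow> real) set" and n
    assume s: "snd s \<in> slices"
    have "\<exists>y\<in>V n. \<forall>j\<in>{()}. \<exists>\<theta>\<in>{-1, 1}. \<exists>C'\<in>slices. C' \<subseteq> snd s \<and> (\<forall>g\<in>C'. 1 - 1 / 2 < \<theta> * g y)"
      by (rule large_on_subslices[OF X]) (use s V in simp_all)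
    then obtain y \<theta> C' where y: "y \<in> V n" and th: "\<theta> \<in> {-1, 1::real}"
      and C': "C' \<in> slices" "C' \<subseteq> snd s" "\<forall>g\<in>C'. 1 - 1 / 2 < \<theta> * g y"
      by blast
    have "1 / 2 < \<bar>g y\<bar>" if "g \<in> C'" for g
      using bspec[OF C'(3) that] th by auto
    then show "\<exists>s'. snd s' \<in> slices \<and> ?Q n s s'"
      using y C' by (intro exI[of _ "(y, C')"]) auto
  qed
  then obtain s where s: "\<And>n. snd (s n) \<in> slices" "\<And>n. ?Q n (s n) (s (Suc n))"
    by blast
  \<comment> \<open>The vector of the initial state is a dummy, hence the shift.\<close>
  define y where "y n = fst (s (Suc n))" for n
  have dec: "snd (s n) \<subseteq> snd (s m)" if "m \<le> n" for m n
    using that by (rule lift_Suc_antimono_le[rotated]) (use s(2) in blast)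
  have "\<exists>g\<in>dual_ball. \<forall>i<n. 1 / 2 \<le> \<bar>g (y i)\<bar>" for n
  proof -
    obtain g where g: "g \<in> snd (s n)"
      using slices_nonempty[OF s(1)[of n]] by blast
    have "1 / 2 \<le> \<bar>g (y i)\<bar>" if "i < n" for i
      using s(2)[of i] dec[of "Suc i" n] g that unfolding y_def
      by (meson Suc_leI less_imp_le subsetD)
    then show ?thesis
      using g slices_subset_dual_ball[OF s(1)[of n]] by blast
  qed
  then have "\<exists>g\<in>dual_ball. \<forall>i. 1 / 2 \<le> \<bar>g (y i)\<bar>"
    by (rule exists_functional_large_on_sequence)
  moreover have "\<forall>n. y n \<in> V n"
    using s(2) by (simp add: y_def)
  ultimately show ?thesis by blast
qed

lemma no_countable_pi_base:
  assumes X: "super_alternative_Daugavet TYPE('a::banach)"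
    and cnt: "countable \<V>"
  shows "\<not> pi_base (weak_unit_ball :: 'a topology) \<V>"
proof
  assume pb: "pi_base (weak_unit_ball :: 'a topology) \<V>"
  have slab: "\<exists>V\<in>\<V>. V \<subseteq> {y \<in> cball 0 1. \<bar>g y\<bar> < 1 / 2}" if "g \<in> dual_ball" for g :: "'a \<Rightarrow> real"
  proof -
    have "openin weak_unit_ball {y \<in> cball 0 1. \<forall>j\<in>{()}. \<bar>g y\<bar> < 1 / 2}"
      by (rule openin_weak_slab) (use that in auto)
    moreover have "0 \<in> {y \<in> cball 0 1. \<bar>g y\<bar> < 1 / 2}"
      using linear_0[OF dual_ball_linear[OF that]] by simp
    ultimately show ?thesis
      using pb unfolding pi_base_def by auto
  qed
  have "\<V> \<noteq> {}"
    using slab exists_norming_functional[of "0::'a"] by blast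
  have "openin weak_unit_ball (from_nat_into \<V> n)" "from_nat_into \<V> n \<noteq> {}" for n
    using pb from_nat_into[OF \<open>\<V> \<noteq> {}\<close>, of n] unfolding pi_base_def by blast+
  then obtain y g where y: "\<forall>n. y n \<in> from_nat_into \<V> n"
      and g: "g \<in> dual_ball" "\<forall>n. 1 / 2 \<le> \<bar>g (y n)\<bar>"
    using exists_sequence_selection_norming[OF X, of "from_nat_into \<V>"] by blast
  obtain V where "V \<in> \<V>" and V: "V \<subseteq> {y \<in> cball 0 1. \<bar>g y\<bar> < 1 / 2}"
    using slab[OF g(1)] by blast
  then obtain n where "from_nat_into \<V> n = V"
    using from_nat_into_surj[OF cnt] by auto
  then have "\<bar>g (y n)\<bar> < 1 / 2"
    using y V by blast
  then show False
    using g(2) by (simp add: not_less[symmetric])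
qed

section \<open>One point that is small and large on subslices\<close>

text \<open>The families \<open>h\<close> of functionals form a weak* compact space, and the families at which a given \<open>y\<close> is
  small form an open set. The conclusion is a finite subcover; indexing the families by the whole type
  \<open>'j\<close> makes their space a full product.\<close>

lemma finite_set_of_small_values:
  fixes G :: "'a::real_normed_vector set" and J :: "'j set"
  assumes J: "finite J"
    and G: "\<And>h :: 'j \<Rightarrow> 'a \<Rightarrow> real. \<forall>j. h j \<in> dual_ball \<Longrightarrow> \<exists>y\<in>G. \<forall>j\<in>J. \<bar>h j y\<bar> < \<delta>"
  shows "\<exists>F. F \<subseteq> G \<and> finite F \<and>
    (\<forall>h :: 'j \<Rightarrow> 'a \<Rightarrow> real. (\<forall>j. h j \<in> dual_ball) \<longrightarrow> (\<exists>y\<in>F. \<forall>j\<in>J. \<bar>h j y\<bar> < \<delta>))"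
proof -
  let ?O = "\<lambda>y. \<Inter>j\<in>J. {h :: 'j \<Rightarrow> 'a \<Rightarrow> real. \<bar>h j y\<bar> < \<delta>}"
  have comp: "compact {h :: 'j \<Rightarrow> 'a \<Rightarrow> real. \<forall>j. h j \<in> dual_ball}"
    by (rule compact_Pi_UNIV) (rule compact_dual_ball)
  have cont: "continuous_on UNIV (\<lambda>h :: 'j \<Rightarrow> 'a \<Rightarrow> real. h j y)" for j y
    by (rule continuous_on_compose2[OF continuous_on_eval continuous_on_product_coordinates]) simp
  have op: "open (?O y)" for y
    by (intro open_INT ballI J open_Collect_less continuous_intros cont)
  have cover: "{h. \<forall>j. h j \<in> dual_ball} \<subseteq> (\<Union>y\<in>G. ?O y)"
  proof
    fix h :: "'j \<Rightarrow> 'a \<Rightarrow> real" assume "h \<in> {h. \<forall>j. h j \<in> dual_ball}"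
    then have "\<exists>y\<in>G. \<forall>j\<in>J. \<bar>h j y\<bar> < \<delta>"
      by (intro G) simp
    then show "h \<in> (\<Union>y\<in>G. ?O y)"
      by simp
  qed
  obtain F where F: "F \<subseteq> G" "finite F" "{h. \<forall>j. h j \<in> dual_ball} \<subseteq> (\<Union>y\<in>F. ?O y)"
    by (rule compactE_image[OF comp op cover])
  show ?thesis
  proof (intro exI[of _ F] conjI F(1,2) allI impI)
    fix h :: "'j \<Rightarrow> 'a \<Rightarrow> real" assume "\<forall>j. h j \<in> dual_ball"
    then have "h \<in> (\<Union>y\<in>F. ?O y)"
      by (intro subsetD[OF F(3)]) simp
    then show "\<exists>y\<in>F. \<forall>j\<in>J. \<bar>h j y\<bar> < \<delta>"
      by simp
  qed
qed

text \<open>The order of the choices is essential. The set \<open>G\<close> of points that are large on subslices meets every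
  weak neighbourhood of \<open>0\<close>. A finite part \<open>F\<close> of \<open>G\<close> is fixed first, then subslices \<open>D j\<close> on which
  all members of \<open>F\<close> oscillate little, and only then \<open>y \<in> F\<close>, small at one functional of each
  \<open>D j\<close> and therefore small on all of \<open>D j\<close>.\<close>

lemma small_and_large_on_subslices:
  fixes C :: "'j \<Rightarrow> ('a::banach \<Rightarrow> real) set"
  assumes X: "super_alternative_Daugavet TYPE('a)"
    and J: "finite J" and C: "\<And>j. j \<in> J \<Longrightarrow> C j \<in> slices" and eta: "0 < \<eta>"
  shows "\<exists>y\<in>cball 0 1. \<forall>j\<in>J.
    (\<exists>C'\<in>slices. C' \<subseteq> C j \<and> (\<forall>g\<in>C'. \<bar>g y\<bar> < \<eta>)) \<and>
    (\<exists>\<theta>\<in>{-1, 1}. \<exists>C'\<in>slices. C' \<subseteq> C j \<and> (\<forall>g\<in>C'. 1 - \<eta> < \<theta> * g y))"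
proof -
  define G where "G = {y \<in> cball 0 1. \<forall>j\<in>J. \<exists>\<theta>\<in>{-1, 1}. \<exists>C'\<in>slices.
      C' \<subseteq> C j \<and> (\<forall>g\<in>C'. 1 - \<eta> < \<theta> * g y)}"
  have "\<exists>y\<in>G. \<forall>j\<in>J. \<bar>h j y\<bar> < \<eta> / 2" if h: "\<forall>j. h j \<in> dual_ball" for h :: "'j \<Rightarrow> 'a \<Rightarrow> real"
  proof -
    let ?W = "{y \<in> cball 0 1. \<forall>j\<in>J. \<bar>h j y\<bar> < \<eta> / 2}"
    have "openin weak_unit_ball ?W"
      by (rule openin_weak_slab[OF J]) (use h in blast)
    moreover have "0 \<in> ?W"
      using linear_0[OF dual_ball_linear[OF h[rule_format]]] eta by simp
    then have "?W \<noteq> {}" by blast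
    ultimately have "\<exists>y\<in>?W. \<forall>j\<in>J. \<exists>\<theta>\<in>{-1, 1}. \<exists>C'\<in>slices.
        C' \<subseteq> C j \<and> (\<forall>g\<in>C'. 1 - \<eta> < \<theta> * g y)"
      by (intro large_on_subslices[OF X J C _ _ eta])
    then show ?thesis
      unfolding G_def by blast
  qed
  from finite_set_of_small_values[OF J this]
  obtain F where F: "F \<subseteq> G" "finite F"
    "\<forall>h :: 'j \<Rightarrow> 'a \<Rightarrow> real. (\<forall>j. h j \<in> dual_ball) \<longrightarrow> (\<exists>y\<in>F. \<forall>j\<in>J. \<bar>h j y\<bar> < \<eta> / 2)"
    by blast
  have "\<forall>j\<in>J. \<exists>C'. C' \<in> slices \<and> C' \<subseteq> C j \<and>
      (\<forall>y\<in>F. \<forall>g\<in>C'. \<forall>h\<in>C'. \<bar>g y - h y\<bar> < \<eta> / 2)"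
    using subslice_small_oscillation[OF F(2) C, of _ "\<eta> / 2"] eta by (simp add: Bex_def)
  then obtain D where D: "\<And>j. j \<in> J \<Longrightarrow> D j \<in> slices" "\<And>j. j \<in> J \<Longrightarrow> D j \<subseteq> C j"
    "\<And>j y g h. j \<in> J \<Longrightarrow> y \<in> F \<Longrightarrow> g \<in> D j \<Longrightarrow> h \<in> D j \<Longrightarrow> \<bar>g y - h y\<bar> < \<eta> / 2"
    by metis
  have "\<exists>g. g \<in> dual_ball \<and> (j \<in> J \<longrightarrow> g \<in> D j)" for j
    using exists_norming_functional[of 0] slices_nonempty[OF D(1)]
      slices_subset_dual_ball[OF D(1)] by blast
  then obtain h where h: "\<And>j. h j \<in> dual_ball" "\<And>j. j \<in> J \<Longrightarrow> h j \<in> D j"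
    by metis
  obtain y where y: "y \<in> F" "\<forall>j\<in>J. \<bar>h j y\<bar> < \<eta> / 2"
    using F(3) h(1) by blast
  have small: "\<exists>C'\<in>slices. C' \<subseteq> C j \<and> (\<forall>g\<in>C'. \<bar>g y\<bar> < \<eta>)" if j: "j \<in> J" for j
  proof -
    have "\<bar>g y\<bar> < \<eta>" if "g \<in> D j" for g
      using D(3)[OF j y(1) that h(2)[OF j]] bspec[OF y(2) j] by linarith
    then show ?thesis
      using D(1,2)[OF j] by blast
  qed
  have "y \<in> G"
    using F(1) y(1) by blast
  then have "y \<in> cball 0 1" and large: "\<forall>j\<in>J. \<exists>\<theta>\<in>{-1, 1}. \<exists>C'\<in>slices.
      C' \<subseteq> C j \<and> (\<forall>g\<in>C'. 1 - \<eta> < \<theta> * g y)"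
    unfolding G_def by blast+
  show ?thesis
    by (intro bexI[OF _ \<open>y \<in> cball 0 1\<close>] ballI conjI small bspec[OF large])
qed

section \<open>Making the signs agree\<close>

lemma weighted_majority_sign:
  fixes w :: "'j \<Rightarrow> real" and \<theta> :: "'j \<Rightarrow> real"
  assumes J: "finite J" and th: "\<And>j. j \<in> J \<Longrightarrow> \<theta> j \<in> {-1, 1}"
  obtains b where "b \<in> {-1, 1}" "(\<Sum>j\<in>J. w j) / 2 \<le> (\<Sum>j\<in>J. if \<theta> j = b then w j else 0)"
proof -
  have "(\<Sum>j\<in>J. if \<theta> j = 1 then w j else 0) + (\<Sum>j\<in>J. if \<theta> j = -1 then w j else 0) = (\<Sum>j\<in>J. w j)"
    unfolding sum.distrib[symmetric] by (rule sum.cong) (use th in auto)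
  then consider "(\<Sum>j\<in>J. w j) / 2 \<le> (\<Sum>j\<in>J. if \<theta> j = 1 then w j else 0)"
    | "(\<Sum>j\<in>J. w j) / 2 \<le> (\<Sum>j\<in>J. if \<theta> j = -1 then w j else 0)"
    by linarith
  then show thesis
    by cases (use that in auto)
qed

text \<open>Multiplicative weights. The vector \<open>v\<close> is a signed sum of \<open>N\<close> points, \<open>m j\<close> counts the steps in
  which the sign of the summand agreed with the sign of the point on the current subslice \<open>P\<close> of
  \<open>C j\<close>, and \<open>(1 / 2) ^ m j\<close> is the weight of \<open>j\<close>. When the signs disagree, \<open>P\<close> is shrunk to a
  subslice where the new point is small, so that nothing is lost. The subslice \<open>Z\<close> only follows the
  steps where the new point is small.\<close>

lemma sign_adjusted_sum:
  fixes C :: "'j \<Rightarrow> ('a::banach \<Rightarrow> real) set"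
  assumes X: "super_alternative_Daugavet TYPE('a)"
    and J: "finite J" and C: "\<And>j. j \<in> J \<Longrightarrow> C j \<in> slices" and eta: "0 < \<eta>"
  shows "\<exists>v m. norm v \<le> real N \<and> (\<Sum>j\<in>J. (1 / 2) ^ m j) \<le> real (card J) * (3 / 4) ^ N \<and>
    (\<forall>j\<in>J. (\<exists>Z\<in>slices. Z \<subseteq> C j \<and> (\<forall>g\<in>Z. \<bar>g v\<bar> \<le> real N * \<eta>)) \<and>
           (\<exists>P\<in>slices. P \<subseteq> C j \<and> (\<forall>g\<in>P. real (m j) - real N * \<eta> \<le> g v)))"
proof (induction N)
  case 0
  have zero: "g 0 = 0" if "g \<in> C j" "j \<in> J" for g j
    using slices_subset_dual_ball[OF C[OF that(2)]] that(1) linear_0[OF dual_ball_linear] by blast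
  show ?case
  proof (rule exI[of _ 0], rule exI[of _ "\<lambda>_. 0"], intro conjI ballI)
    fix j assume j: "j \<in> J"
    show "\<exists>Z\<in>slices. Z \<subseteq> C j \<and> (\<forall>g\<in>Z. \<bar>g 0\<bar> \<le> real 0 * \<eta>)"
      using C[OF j] zero[OF _ j] by (intro bexI[of _ "C j"]) auto
    have "real 0 - real 0 * \<eta> \<le> g 0" if "g \<in> C j" for g
      using zero[OF that j] by simp
    then show "\<exists>P\<in>slices. P \<subseteq> C j \<and> (\<forall>g\<in>P. real 0 - real 0 * \<eta> \<le> g 0)"
      using C[OF j] by blast
  qed simp_all
next
  case (Suc N)
  then obtain v m where v: "norm v \<le> real N"
    and m: "(\<Sum>j\<in>J. (1 / 2) ^ m j) \<le> real (card J) * (3 / 4) ^ N"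
    and ZP: "\<forall>j\<in>J. (\<exists>Z\<in>slices. Z \<subseteq> C j \<and> (\<forall>g\<in>Z. \<bar>g v\<bar> \<le> real N * \<eta>)) \<and>
           (\<exists>P\<in>slices. P \<subseteq> C j \<and> (\<forall>g\<in>P. real (m j) - real N * \<eta> \<le> g v))"
    by blast
  from ZP obtain Z P where
      Z: "\<And>j. j \<in> J \<Longrightarrow> Z j \<in> slices \<and> Z j \<subseteq> C j \<and> (\<forall>g\<in>Z j. \<bar>g v\<bar> \<le> real N * \<eta>)"
    and P: "\<And>j. j \<in> J \<Longrightarrow> P j \<in> slices \<and> P j \<subseteq> C j \<and>
        (\<forall>g\<in>P j. real (m j) - real N * \<eta> \<le> g v)"
    by metis
  \<comment> \<open>Both current subslices of each \<open>C j\<close> must be split by the same point \<open>y\<close>.\<close>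
  let ?E = "\<lambda>i. if snd i then P (fst i) else Z (fst i)"
  let ?both = "\<lambda>y D. (\<exists>C'\<in>slices. C' \<subseteq> D \<and> (\<forall>g\<in>C'. \<bar>g y\<bar> < \<eta>)) \<and>
    (\<exists>\<theta>\<in>{-1, 1}. \<exists>C'\<in>slices. C' \<subseteq> D \<and> (\<forall>g\<in>C'. 1 - \<eta> < \<theta> * g y))"
  have "\<exists>y\<in>cball 0 1. \<forall>i\<in>J \<times> (UNIV :: bool set). ?both y (?E i)"
    by (rule small_and_large_on_subslices[OF X _ _ eta]) (use J Z P in auto)
  then obtain y where y: "y \<in> cball 0 1"
    and all: "\<forall>i\<in>J \<times> (UNIV :: bool set). ?both y (?E i)"
    by (rule bexE)
  have yZ: "?both y (Z j)" and yP: "?both y (P j)" if "j \<in> J" for j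
    using bspec[OF all, of "(j, False)"] bspec[OF all, of "(j, True)"] that by simp_all
  have "\<exists>D. D \<in> slices \<and> D \<subseteq> Z j \<and> (\<forall>g\<in>D. \<bar>g y\<bar> < \<eta>)" if "j \<in> J" for j
    using yZ[OF that] by blast
  then obtain Z' where Z': "\<And>j. j \<in> J \<Longrightarrow> Z' j \<in> slices \<and> Z' j \<subseteq> Z j \<and> (\<forall>g\<in>Z' j. \<bar>g y\<bar> < \<eta>)"
    by metis
  have "\<exists>D. D \<in> slices \<and> D \<subseteq> P j \<and> (\<forall>g\<in>D. \<bar>g y\<bar> < \<eta>)" if "j \<in> J" for j
    using yP[OF that] by blast
  then obtain P0 where P0: "\<And>j. j \<in> J \<Longrightarrow> P0 j \<in> slices \<and> P0 j \<subseteq> P j \<and> (\<forall>g\<in>P0 j. \<bar>g y\<bar> < \<eta>)"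
    by metis
  have "\<exists>\<theta> D. \<theta> \<in> {-1, 1} \<and> D \<in> slices \<and> D \<subseteq> P j \<and> (\<forall>g\<in>D. 1 - \<eta> < \<theta> * g y)" if "j \<in> J" for j
    using conjunct2[OF yP[OF that]] by blast
  then obtain \<theta> P1 where th: "\<And>j. j \<in> J \<Longrightarrow> \<theta> j \<in> {-1, 1}"
    and P1: "\<And>j. j \<in> J \<Longrightarrow> P1 j \<in> slices \<and> P1 j \<subseteq> P j \<and> (\<forall>g\<in>P1 j. 1 - \<eta> < \<theta> j * g y)"
    by metis
  obtain b where b: "b \<in> {-1, 1}"
    and maj: "(\<Sum>j\<in>J. (1 / 2 :: real) ^ m j) / 2 \<le> (\<Sum>j\<in>J. if \<theta> j = b then (1 / 2) ^ m j else 0)"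
    by (rule weighted_majority_sign[where w = "\<lambda>j. (1 / 2) ^ m j" and \<theta> = \<theta>, OF J th])
  define v' where "v' = v + b *\<^sub>R y"
  define m' where "m' j = (if \<theta> j = b then Suc (m j) else m j)" for j
  have lin: "g v' = g v + b * g y" if "g \<in> dual_ball" for g
    using dual_ball_linear[OF that] by (simp add: v'_def linear_add linear_scale)
  have "norm v' \<le> norm v + norm (b *\<^sub>R y)"
    unfolding v'_def by (rule norm_triangle_ineq)
  also have "norm (b *\<^sub>R y) \<le> 1"
    using b y by auto
  finally have nv: "norm v' \<le> real (Suc N)"
    using v by simp
  have "(\<Sum>j\<in>J. (1 / 2) ^ m' j) =
      (\<Sum>j\<in>J. (1 / 2 :: real) ^ m j - (if \<theta> j = b then (1 / 2) ^ m j else 0) / 2)"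
    by (rule sum.cong) (auto simp: m'_def)
  also have "\<dots> = (\<Sum>j\<in>J. (1 / 2) ^ m j) - (\<Sum>j\<in>J. if \<theta> j = b then (1 / 2) ^ m j else 0) / 2"
    by (simp add: sum_subtractf sum_divide_distrib)
  also have "\<dots> \<le> 3 / 4 * (\<Sum>j\<in>J. (1 / 2) ^ m j)"
    using maj by linarith
  also have "\<dots> \<le> real (card J) * (3 / 4) ^ Suc N"
    using m by simp
  finally have m'_sum: "(\<Sum>j\<in>J. (1 / 2) ^ m' j) \<le> real (card J) * (3 / 4) ^ Suc N" .
  have "(\<exists>Z\<in>slices. Z \<subseteq> C j \<and> (\<forall>g\<in>Z. \<bar>g v'\<bar> \<le> real (Suc N) * \<eta>)) \<and>
        (\<exists>P\<in>slices. P \<subseteq> C j \<and> (\<forall>g\<in>P. real (m' j) - real (Suc N) * \<eta> \<le> g v'))"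
    (is "?conj j") if j: "j \<in> J" for j
  proof
    have dual: "g \<in> dual_ball" if "g \<in> C j" for g
      using slices_subset_dual_ball[OF C[OF j]] that by blast
    have small: "\<bar>b * g y\<bar> \<le> \<eta>" if "\<bar>g y\<bar> < \<eta>" for g
      using that b by auto
    have N: "real (Suc N) * \<eta> = real N * \<eta> + \<eta>"
      by (simp add: distrib_right)
    have bound: "\<bar>g v'\<bar> \<le> real (Suc N) * \<eta>" if "g \<in> Z' j" for g
    proof -
      have "g \<in> C j" "\<bar>g v\<bar> \<le> real N * \<eta>" "\<bar>g y\<bar> < \<eta>"
        using Z'[OF j] Z[OF j] that by auto
      then show ?thesis
        using lin[OF dual, of g] small[of g] N by linarith
    qed
    show "\<exists>Z\<in>slices. Z \<subseteq> C j \<and> (\<forall>g\<in>Z. \<bar>g v'\<bar> \<le> real (Suc N) * \<eta>)"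
      by (intro bexI[of _ "Z' j"] conjI ballI bound) (use Z'[OF j] Z[OF j] in blast)+
    show "\<exists>P\<in>slices. P \<subseteq> C j \<and> (\<forall>g\<in>P. real (m' j) - real (Suc N) * \<eta> \<le> g v')"
    proof (cases "\<theta> j = b")
      case True
      have bound: "real (m' j) - real (Suc N) * \<eta> \<le> g v'" if "g \<in> P1 j" for g
      proof -
        have "g \<in> C j" "real (m j) - real N * \<eta> \<le> g v" "1 - \<eta> < b * g y"
          using P1[OF j] P[OF j] that True by auto
        moreover have "real (m' j) = real (m j) + 1"
          using True by (simp add: m'_def)
        ultimately show ?thesis
          using lin[OF dual, of g] N by linarith
      qed
      show ?thesis
        by (intro bexI[of _ "P1 j"] conjI ballI bound) (use P1[OF j] P[OF j] in blast)+
    next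
      case False
      have bound: "real (m' j) - real (Suc N) * \<eta> \<le> g v'" if "g \<in> P0 j" for g
      proof -
        have "g \<in> C j" "real (m j) - real N * \<eta> \<le> g v" "\<bar>g y\<bar> < \<eta>"
          using P0[OF j] P[OF j] that by auto
        moreover have "real (m' j) = real (m j)"
          using False by (simp add: m'_def)
        ultimately show ?thesis
          using lin[OF dual, of g] small[of g] N by linarith
      qed
      show ?thesis
        by (intro bexI[of _ "P0 j"] conjI ballI bound) (use P0[OF j] P[OF j] in blast)+
    qed
  qed
  then have "\<forall>j\<in>J. ?conj j"
    by (rule ballI)
  with nv m'_sum show ?case
    by (intro exI conjI)
qed

text \<open>After \<open>4 M\<close> steps each \<open>m j\<close> is at least \<open>M\<close>: otherwise the weight \<open>(1/2) ^ m j \<ge> (1/2) ^ M\<close> of a single \<open>j\<close> would be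
  at most \<open>card J * (3/4) ^ (4 * M)\<close>, which fails for large \<open>M\<close> because \<open>2 (3/4)\<^sup>4 = 81/128 < 1\<close>. So
  the average is at least \<open>1/4 - 1/20 = 1/5\<close> on the subslices \<open>P\<close>.\<close>

lemma small_and_positive_on_subslices:
  fixes C :: "'j \<Rightarrow> ('a::banach \<Rightarrow> real) set"
  assumes X: "super_alternative_Daugavet TYPE('a)"
    and J: "finite J" and C: "\<And>j. j \<in> J \<Longrightarrow> C j \<in> slices"
  shows "\<exists>z\<in>cball 0 1. \<forall>j\<in>J.
    (\<exists>Z\<in>slices. Z \<subseteq> C j \<and> (\<forall>g\<in>Z. \<bar>g z\<bar> \<le> 1 / 20)) \<and>
    (\<exists>P\<in>slices. P \<subseteq> C j \<and> (\<forall>g\<in>P. 1 / 5 \<le> g z))"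
proof -
  have "(\<lambda>M. real (card J) * (81 / 128) ^ M) \<longlonglongrightarrow> real (card J) * 0"
    by (intro tendsto_mult_left LIMSEQ_realpow_zero) auto
  then have "\<forall>\<^sub>F M in sequentially. real (card J) * (81 / 128) ^ M < 1"
    by (rule order_tendstoD) simp
  then have "\<forall>\<^sub>F M in sequentially. real (card J) * (81 / 128) ^ M < 1 \<and> 0 < M"
    using eventually_gt_at_top[of 0] by (rule eventually_conj)
  then obtain M where M: "real (card J) * (81 / 128) ^ M < 1" "0 < M"
    by (auto simp: eventually_sequentially)
  have "0 < (1 / 20 :: real)" by simp
  from sign_adjusted_sum[where C = C and J = J and N = "4 * M", OF X J C this]
  obtain v m where v: "norm v \<le> real (4 * M)"
    and m: "(\<Sum>j\<in>J. (1 / 2) ^ m j) \<le> real (card J) * (3 / 4) ^ (4 * M)"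
    and ZP: "\<forall>j\<in>J. (\<exists>Z\<in>slices. Z \<subseteq> C j \<and> (\<forall>g\<in>Z. \<bar>g v\<bar> \<le> real (4 * M) * (1 / 20))) \<and>
           (\<exists>P\<in>slices. P \<subseteq> C j \<and> (\<forall>g\<in>P. real (m j) - real (4 * M) * (1 / 20) \<le> g v))"
    by blast
  have M_le: "M \<le> m j" if j: "j \<in> J" for j
  proof (rule ccontr)
    assume "\<not> M \<le> m j"
    then have "(1 / 2 :: real) ^ M \<le> (1 / 2) ^ m j"
      by (intro power_decreasing) auto
    also have "\<dots> \<le> (\<Sum>j\<in>J. (1 / 2) ^ m j)"
      by (rule member_le_sum) (use j J in auto)
    also have "\<dots> \<le> real (card J) * (81 / 256) ^ M"
      using m by (simp add: power_mult power_divide)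
    finally have "2 ^ M * (1 / 2 :: real) ^ M \<le> 2 ^ M * (real (card J) * (81 / 256) ^ M)"
      by (rule mult_left_mono) simp
    also have "2 ^ M * (1 / 2 :: real) ^ M = 1"
      by (simp flip: power_mult_distrib)
    also have "2 ^ M * (real (card J) * (81 / 256) ^ M) = real (card J) * (2 ^ M * (81 / 256) ^ M)"
      by simp
    also have "2 ^ M * (81 / 256 :: real) ^ M = (81 / 128) ^ M"
      by (simp flip: power_mult_distrib)
    finally show False using M(1) by simp
  qed
  define z where "z = (1 / (4 * real M)) *\<^sub>R v"
  have gz: "g z = g v / (4 * real M)" if "g \<in> C j" "j \<in> J" for g j
    using slices_subset_dual_ball[OF C[OF that(2)]] that(1) dual_ball_linear[of g]
    by (auto simp: z_def linear_scale)
  have "(\<exists>Z\<in>slices. Z \<subseteq> C j \<and> (\<forall>g\<in>Z. \<bar>g z\<bar> \<le> 1 / 20)) \<and>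
    (\<exists>P\<in>slices. P \<subseteq> C j \<and> (\<forall>g\<in>P. 1 / 5 \<le> g z))" if j: "j \<in> J" for j
  proof
    obtain Z where Z: "Z \<in> slices" "Z \<subseteq> C j" "\<forall>g\<in>Z. \<bar>g v\<bar> \<le> real (4 * M) * (1 / 20)"
      using ZP j by blast
    have "\<bar>g z\<bar> \<le> 1 / 20" if "g \<in> Z" for g
      using Z that M(2) by (simp add: gz[OF _ j] subset_iff field_simps)
    then show "\<exists>Z\<in>slices. Z \<subseteq> C j \<and> (\<forall>g\<in>Z. \<bar>g z\<bar> \<le> 1 / 20)"
      using Z by blast
    obtain P where P: "P \<in> slices" "P \<subseteq> C j"
        "\<forall>g\<in>P. real (m j) - real (4 * M) * (1 / 20) \<le> g v"
      using ZP j by blast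
    have "1 / 5 \<le> g z" if g: "g \<in> P" for g
    proof -
      have "real M \<le> real (m j)"
        using M_le[OF j] by simp
      then have "real (4 * M) * (1 / 5) \<le> g v"
        using bspec[OF P(3) g] by simp
      moreover have "g \<in> C j" using P(2) g by blast
      ultimately show ?thesis
        using M(2) by (simp add: gz[OF _ j] field_simps)
    qed
    then show "\<exists>P\<in>slices. P \<subseteq> C j \<and> (\<forall>g\<in>P. 1 / 5 \<le> g z)"
      using P by blast
  qed
  moreover have "z \<in> cball 0 1"
    using v M(2) by (simp add: z_def field_simps)
  ultimately show ?thesis by blast
qed

section \<open>A sequence equivalent to the unit vector basis\<close>

text \<open>A binary tree of slices: the state after \<open>n\<close> steps holds a slice for each \<open>A \<subseteq> {..<n}\<close>, on which the
  vectors chosen so far are large exactly at the indices in \<open>A\<close>. All slices of one level are split by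
  the same next vector.\<close>

lemma exists_independent_sequence:
  assumes X: "super_alternative_Daugavet TYPE('a::banach)"
  shows "\<exists>z :: nat \<Rightarrow> 'a. (\<forall>n. norm (z n) \<le> 1) \<and>
    (\<forall>n A. A \<subseteq> {..<n} \<longrightarrow>
      (\<exists>g\<in>dual_ball. \<forall>i<n. if i \<in> A then 1 / 5 \<le> g (z i) else \<bar>g (z i)\<bar> \<le> 1 / 20))"
proof -
  let ?split = "\<lambda>n A (g :: 'a \<Rightarrow> real) z. if n \<in> A then 1 / 5 \<le> g z else \<bar>g z\<bar> \<le> 1 / 20"
  let ?P = "\<lambda>n (s :: 'a \<times> (nat set \<Rightarrow> ('a \<Rightarrow> real) set)). \<forall>A. A \<subseteq> {..<n} \<longrightarrow> snd s A \<in> slices"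
  let ?Q = "\<lambda>n (s :: 'a \<times> (nat set \<Rightarrow> ('a \<Rightarrow> real) set)) s'. norm (fst s') \<le> 1 \<and>
      (\<forall>A. A \<subseteq> {..<Suc n} \<longrightarrow> snd s' A \<subseteq> snd s (A \<inter> {..<n}) \<and>
         (\<forall>g\<in>snd s' A. ?split n A g (fst s')))"
  have "\<exists>s. \<forall>n. ?P n (s n) \<and> ?Q n (s n) (s (Suc n))"
  proof (rule dependent_nat_choice)
    obtain C :: "('a \<Rightarrow> real) set" where "C \<in> slices"
      using exists_slice[OF X] by blast
    then show "\<exists>s. ?P 0 s"
      by (intro exI[of _ "(0, \<lambda>_. C)"]) simp
  next
    fix s n
    assume s: "?P n s"
    have "\<exists>z\<in>cball 0 1. \<forall>A\<in>Pow {..<n}.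
        (\<exists>Z\<in>slices. Z \<subseteq> snd s A \<and> (\<forall>g\<in>Z. \<bar>g z\<bar> \<le> 1 / 20)) \<and>
        (\<exists>P\<in>slices. P \<subseteq> snd s A \<and> (\<forall>g\<in>P. 1 / 5 \<le> g z))"
      by (rule small_and_positive_on_subslices[OF X]) (use s in auto)
    then obtain z where z: "norm z \<le> 1"
      and ZP: "\<forall>A\<in>Pow {..<n}.
        (\<exists>Z\<in>slices. Z \<subseteq> snd s A \<and> (\<forall>g\<in>Z. \<bar>g z\<bar> \<le> 1 / 20)) \<and>
        (\<exists>P\<in>slices. P \<subseteq> snd s A \<and> (\<forall>g\<in>P. 1 / 5 \<le> g z))"
      by auto
    from ZP obtain Z P where
        Z: "\<And>A. A \<in> Pow {..<n} \<Longrightarrow> Z A \<in> slices \<and> Z A \<subseteq> snd s A \<and> (\<forall>g\<in>Z A. \<bar>g z\<bar> \<le> 1 / 20)"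
      and P: "\<And>A. A \<in> Pow {..<n} \<Longrightarrow> P A \<in> slices \<and> P A \<subseteq> snd s A \<and> (\<forall>g\<in>P A. 1 / 5 \<le> g z)"
      by metis
    define C where "C A = (if n \<in> A then P (A \<inter> {..<n}) else Z (A \<inter> {..<n}))" for A
    have C: "C A \<in> slices" "C A \<subseteq> snd s (A \<inter> {..<n})" "\<forall>g\<in>C A. ?split n A g z" for A
      using Z[of "A \<inter> {..<n}"] P[of "A \<inter> {..<n}"] by (simp_all add: C_def)
    show "\<exists>s'. ?P (Suc n) s' \<and> ?Q n s s'"
      by (intro exI[of _ "(z, C)"], unfold fst_conv snd_conv) (intro conjI allI impI C z)
  qed
  then obtain s where s: "\<forall>n. ?P n (s n) \<and> ?Q n (s n) (s (Suc n))"
    by (rule exE)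
  have P: "?P n (s n)" for n
    using spec[OF s, of n] by (rule conjunct1)
  have Q: "?Q n (s n) (s (Suc n))" for n
    using spec[OF s, of n] by (rule conjunct2)
  define z where "z n = fst (s (Suc n))" for n
  have split: "\<forall>i<n. ?split i A g (z i)" if "A \<subseteq> {..<n}" "g \<in> snd (s n) A" for n A g
    using that
  proof (induction n arbitrary: A)
    case 0
    then show ?case by simp
  next
    case (Suc n)
    have step: "snd (s (Suc n)) A \<subseteq> snd (s n) (A \<inter> {..<n}) \<and>
        (\<forall>g\<in>snd (s (Suc n)) A. ?split n A g (z n))"
      unfolding z_def by (rule mp[OF spec[OF conjunct2[OF Q]] Suc.prems(1)])
    have IH: "\<forall>i<n. ?split i (A \<inter> {..<n}) g (z i)"
      by (rule Suc.IH) (use step Suc.prems(2) in blast)+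
    have last: "?split n A g (z n)"
      using step Suc.prems(2) by (rule bspec[OF conjunct2])
    show ?case
    proof (intro allI impI)
      fix i assume "i < Suc n"
      then consider "i = n" | "i < n" by linarith
      then show "?split i A g (z i)"
      proof cases
        case 1
        with last show ?thesis by (simp only:)
      next
        case 2
        then show ?thesis using spec[OF IH, of i] by simp
      qed
    qed
  qed
  have "\<exists>g\<in>dual_ball. \<forall>i<n. ?split i A g (z i)" if A: "A \<subseteq> {..<n}" for n A
  proof -
    have sl: "snd (s n) A \<in> slices"
      using P A by blast
    then obtain g where "g \<in> snd (s n) A"
      using slices_nonempty by blast
    then show ?thesis
      using split[OF A] slices_subset_dual_ball[OF sl] by blast
  qed
  moreover have "norm (z n) \<le> 1" for n
    using Q by (simp add: z_def)
  ultimately show ?thesis by blast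
qed

text \<open>The functional that is large on the indices of positive coefficients shows that the norm is at least
  \<open>1/5\<close> of the positive part minus \<open>1/20\<close> of the negative part. Adding the same estimate for
  \<open>- a\<close> gives \<open>2 \<parallel>v\<parallel> \<ge> (1/5 - 1/20) \<Sum> \<bar>a i\<bar>\<close>.\<close>

lemma independent_sequence_lower_bound:
  fixes z :: "nat \<Rightarrow> 'a::real_normed_vector" and a :: "nat \<Rightarrow> real"
  assumes z: "\<And>A. A \<subseteq> {..<n} \<Longrightarrow>
    \<exists>g\<in>dual_ball. \<forall>i<n. if i \<in> A then 1 / 5 \<le> g (z i) else \<bar>g (z i)\<bar> \<le> 1 / 20"
  shows "3 / 40 * (\<Sum>i<n. \<bar>a i\<bar>) \<le> norm (\<Sum>i<n. a i *\<^sub>R z i)"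
proof -
  let ?v = "\<lambda>a :: nat \<Rightarrow> real. \<Sum>i<n. a i *\<^sub>R z i"
  let ?c = "\<lambda>t :: real. if 0 < t then \<bar>t\<bar> / 5 else - \<bar>t\<bar> / 20"
  have half: "(\<Sum>i<n. ?c (a i)) \<le> norm (?v a)" for a
  proof -
    let ?A = "{i. i < n \<and> 0 < a i}"
    have "?A \<subseteq> {..<n}" by auto
    from z[OF this] obtain g where g: "g \<in> dual_ball"
      and gA: "\<forall>i<n. if i \<in> ?A then 1 / 5 \<le> g (z i) else \<bar>g (z i)\<bar> \<le> 1 / 20"
      by (rule bexE)
    have gi: "if 0 < a i then 1 / 5 \<le> g (z i) else \<bar>g (z i)\<bar> \<le> 1 / 20" if "i < n" for i
      using gA[rule_format, OF that] that by simp
    have "?c (a i) \<le> a i * g (z i)" if "i < n" for i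
    proof (cases "0 < a i")
      case True
      then show ?thesis using gi[OF that] by simp
    next
      case False
      have "\<bar>a i * g (z i)\<bar> \<le> \<bar>a i\<bar> * (1 / 20)"
        unfolding abs_mult using gi[OF that] False by (intro mult_left_mono) auto
      moreover have "?c (a i) = - (\<bar>a i\<bar> * (1 / 20))"
        using False by simp
      ultimately show ?thesis by linarith
    qed
    then have "(\<Sum>i<n. ?c (a i)) \<le> (\<Sum>i<n. a i * g (z i))"
      by (intro sum_mono) simp
    also have "\<dots> = g (?v a)"
      using dual_ball_linear[OF g] by (simp add: linear_sum linear_scale)
    also have "\<dots> \<le> norm (?v a)"
      using g by (rule dual_ball_le)
    finally show ?thesis .
  qed
  have "?v (\<lambda>i. - a i) = - ?v a"
    by (simp add: sum_negf)
  then have "(\<Sum>i<n. ?c (a i)) + (\<Sum>i<n. ?c (- a i)) \<le> 2 * norm (?v a)"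
    using half[of a] half[of "\<lambda>i. - a i"] by simp
  moreover have "3 / 20 * (\<Sum>i<n. \<bar>a i\<bar>) \<le> (\<Sum>i<n. ?c (a i)) + (\<Sum>i<n. ?c (- a i))"
    unfolding sum_distrib_left sum.distrib[symmetric] by (rule sum_mono) auto
  ultimately show ?thesis
    by linarith
qed

section \<open>Copies of \<open>\<ell>\<^sub>1\<close>\<close>

lemma norm_ell1_eq: "norm a = (\<Sum>n. \<bar>ell1_nth a n\<bar>)"
  by (rule norm_ell1.rep_eq)

lemma sum_ell1_le_norm: "(\<Sum>n<N. \<bar>ell1_nth a n\<bar>) \<le> norm a"
  unfolding norm_ell1_eq by (rule sum_le_suminf[OF summable_ell1]) auto

lemma ell1_nth_le_norm: "\<bar>ell1_nth a n\<bar> \<le> norm a"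
proof -
  have "\<bar>ell1_nth a n\<bar> \<le> (\<Sum>i<Suc n. \<bar>ell1_nth a i\<bar>)"
    by (rule member_le_sum[where f = "\<lambda>i. \<bar>ell1_nth a i\<bar>"]) auto
  also have "\<dots> \<le> norm a"
    by (rule sum_ell1_le_norm)
  finally show ?thesis .
qed

text \<open>Completeness makes the range of an embedding of \<open>\<ell>\<^sub>1\<close> closed.\<close>

lemma complete_ell1: "complete (UNIV :: ell1 set)"
proof (rule completeI)
  fix f :: "nat \<Rightarrow> ell1"
  assume "Cauchy f"
  then have C: "\<exists>N. \<forall>j\<ge>N. \<forall>k\<ge>N. norm (f j - f k) < e" if "0 < e" for e
    using that by (auto simp: Cauchy_def dist_norm)
  have "\<exists>l. (\<lambda>k. ell1_nth (f k) n) \<longlonglongrightarrow> l" for n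
  proof -
    have "Cauchy (\<lambda>k. ell1_nth (f k) n)"
    proof (rule metric_CauchyI)
      fix e :: real assume "0 < e"
      then obtain N where N: "\<forall>j\<ge>N. \<forall>k\<ge>N. norm (f j - f k) < e"
        using C by blast
      have "dist (ell1_nth (f j) n) (ell1_nth (f k) n) < e" if "j \<ge> N" "k \<ge> N" for j k
        using N that ell1_nth_le_norm[of "f j - f k" n]
        by (force simp: dist_real_def minus_ell1.rep_eq)
      then show "\<exists>N. \<forall>j\<ge>N. \<forall>k\<ge>N. dist (ell1_nth (f j) n) (ell1_nth (f k) n) < e"
        by blast
    qed
    then show ?thesis
      by (simp add: Cauchy_convergent_iff convergent_def)
  qed
  then obtain l where l: "\<And>n. (\<lambda>k. ell1_nth (f k) n) \<longlonglongrightarrow> l n"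
    by metis
  have tail: "(\<Sum>n<M. \<bar>l n - ell1_nth (f k) n\<bar>) \<le> e"
    if N: "\<forall>j\<ge>N. \<forall>k\<ge>N. norm (f j - f k) < e" and k: "k \<ge> N" for N e k M
  proof (rule tendsto_upperbound)
    show "(\<lambda>j. \<Sum>n<M. \<bar>ell1_nth (f j) n - ell1_nth (f k) n\<bar>) \<longlonglongrightarrow>
        (\<Sum>n<M. \<bar>l n - ell1_nth (f k) n\<bar>)"
      by (intro tendsto_intros l)
    have "(\<Sum>n<M. \<bar>ell1_nth (f j) n - ell1_nth (f k) n\<bar>) \<le> e" if "j \<ge> N" for j
      using sum_ell1_le_norm[where N = M and a = "f j - f k"] N k that
      by (force simp: minus_ell1.rep_eq)
    then show "\<forall>\<^sub>F j in sequentially. (\<Sum>n<M. \<bar>ell1_nth (f j) n - ell1_nth (f k) n\<bar>) \<le> e"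
      unfolding eventually_sequentially by blast
  qed simp
  obtain N1 where N1: "\<forall>j\<ge>N1. \<forall>k\<ge>N1. norm (f j - f k) < 1"
    using C[of 1] by auto
  have sum_diff: "summable (\<lambda>n. \<bar>l n - ell1_nth (f N1) n\<bar>)"
    by (rule summableI_nonneg_bounded[of _ 1]) (use tail[OF N1, of N1] in auto)
  have "summable (\<lambda>n. \<bar>l n\<bar>)"
    by (rule summable_comparison_test'[OF summable_add[OF sum_diff summable_ell1[of "f N1"]], of 0])
      auto
  then have L: "ell1_nth (Abs_ell1 l) = l"
    by (intro Abs_ell1_inverse) simp
  have "f \<longlonglongrightarrow> Abs_ell1 l"
  proof (rule metric_LIMSEQ_I)
    fix e :: real assume e: "0 < e"
    then obtain N where N: "\<forall>j\<ge>N. \<forall>k\<ge>N. norm (f j - f k) < e / 2"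
      using C[of "e / 2"] by auto
    have "dist (f k) (Abs_ell1 l) < e" if k: "k \<ge> N" for k
    proof -
      have "norm (Abs_ell1 l - f k) \<le> e / 2"
        unfolding norm_ell1_eq
        by (rule suminf_le_const[OF summable_ell1])
          (use tail[OF N k] in \<open>simp add: minus_ell1.rep_eq L\<close>)
      then show ?thesis
        using e by (simp add: dist_norm norm_minus_commute)
    qed
    then show "\<exists>N. \<forall>k\<ge>N. dist (f k) (Abs_ell1 l) < e"
      by blast
  qed
  then show "\<exists>L\<in>UNIV. f \<longlonglongrightarrow> L" by blast
qed

text \<open>The copy is the range of \<open>a \<mapsto> \<Sum> a\<^sub>n z\<^sub>n\<close>. The bound on the norms of the \<open>z n\<close> makes this map
  continuous, and the lower bound passes from finite sums to the limit.\<close>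

lemma contains_ell1_if_lower_bound:
  fixes z :: "nat \<Rightarrow> 'a::banach"
  assumes z: "\<And>n. norm (z n) \<le> 1" and c: "0 < c"
    and low: "\<And>a n. c * (\<Sum>i<n. \<bar>a i\<bar>) \<le> norm (\<Sum>i<n. a i *\<^sub>R z i)"
  shows "contains_isomorphic_copy TYPE('a) TYPE(ell1)"
proof -
  define T where "T a = (\<Sum>n. ell1_nth a n *\<^sub>R z n)" for a
  have le: "norm (ell1_nth a n *\<^sub>R z n) \<le> \<bar>ell1_nth a n\<bar>" for a n
    using mult_left_mono[OF z, of "\<bar>ell1_nth a n\<bar>" n] by simp
  have sn: "summable (\<lambda>n. norm (ell1_nth a n *\<^sub>R z n))" for a
    by (rule summable_comparison_test'[OF summable_ell1[of a], of 0]) (use le[of a] in simp)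
  have sT: "summable (\<lambda>n. ell1_nth a n *\<^sub>R z n)" for a
    by (rule summable_norm_cancel[OF sn])
  have norm_T: "norm (T a) \<le> norm a" for a
  proof -
    have "norm (T a) \<le> (\<Sum>n. norm (ell1_nth a n *\<^sub>R z n))"
      unfolding T_def by (rule summable_norm[OF sn])
    also have "\<dots> \<le> norm a"
      unfolding norm_ell1_eq by (rule suminf_le[OF le sn summable_ell1])
    finally show ?thesis .
  qed
  have bl: "bounded_linear T"
  proof (rule bounded_linear_intro[of T 1])
    show "T (a + b) = T a + T b" for a b
      unfolding T_def suminf_add[OF sT sT] by (simp add: plus_ell1.rep_eq scaleR_add_left)
    show "T (r *\<^sub>R a) = r *\<^sub>R T a" for r a
      unfolding T_def suminf_scaleR_right[OF sT] by (simp add: scaleR_ell1.rep_eq)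
    show "norm (T a) \<le> norm a * 1" for a
      using norm_T by simp
  qed
  then have lin: "linear T"
    by (rule bounded_linear.linear)
  have lower: "c * norm a \<le> norm (T a)" for a
  proof (rule LIMSEQ_le)
    show "(\<lambda>n. c * (\<Sum>i<n. \<bar>ell1_nth a i\<bar>)) \<longlonglongrightarrow> c * norm a"
      unfolding norm_ell1_eq by (intro tendsto_mult_left summable_LIMSEQ summable_ell1)
    show "(\<lambda>n. norm (\<Sum>i<n. ell1_nth a i *\<^sub>R z i)) \<longlonglongrightarrow> norm (T a)"
      unfolding T_def by (intro tendsto_norm summable_LIMSEQ sT)
  qed (use low in blast)
  have inj: "inj T"
  proof (rule linear_injective_0[THEN iffD2, OF lin], intro allI impI)
    fix a assume "T a = 0"
    then have "c * norm a \<le> 0" using lower[of a] by simp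
    then show "a = 0" using c by (simp add: mult_le_0_iff)
  qed
  have "complete (range T)"
    by (rule complete_isometric_image[OF c subspace_UNIV bl _ complete_ell1]) (use lower in blast)
  then have closed: "closed (range T)"
    by (rule complete_imp_closed)
  have "(1 / c)-lipschitz_on (range T) (inv T)"
  proof (rule lipschitz_onI)
    fix u v assume "u \<in> range T" "v \<in> range T"
    then obtain a b where ab: "u = T a" "v = T b" by blast
    have "c * norm (a - b) \<le> norm (u - v)"
      using lower[of "a - b"] by (simp add: ab linear_diff[OF lin])
    then show "dist (inv T u) (inv T v) \<le> 1 / c * dist u v"
      using c by (simp add: ab inv_f_f[OF inj] dist_norm field_simps)
  qed (use c in simp)
  then have "continuous_on (range T) (inv T)"
    by (rule lipschitz_on_continuous_on)
  then have "homeomorphism UNIV (range T) T (inv T)"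
    using linear_continuous_on[OF bl] inj
    by (intro homeomorphismI) (auto simp: f_inv_into_f)
  then show ?thesis
    unfolding contains_isomorphic_copy_def
    using lin closed linear_subspace_image[OF lin subspace_UNIV] by blast
qed

theorem theorem1p5:
  assumes "super_alternative_Daugavet TYPE('a::banach)"
  shows "\<not> (\<exists>\<V>. countable \<V> \<and> pi_base (weak_unit_ball :: 'a topology) \<V>)
    \<and> contains_isomorphic_copy TYPE('a) TYPE(ell1)"
proof
  show "\<not> (\<exists>\<V>. countable \<V> \<and> pi_base (weak_unit_ball :: 'a topology) \<V>)"
    using no_countable_pi_base[OF assms] by blast
  obtain z :: "nat \<Rightarrow> 'a" where z: "\<And>n. norm (z n) \<le> 1"
    and ind: "\<And>n A. A \<subseteq> {..<n} \<Longrightarrow>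
      \<exists>g\<in>dual_ball. \<forall>i<n. if i \<in> A then 1 / 5 \<le> g (z i) else \<bar>g (z i)\<bar> \<le> 1 / 20"
    using exists_independent_sequence[OF assms] by blast
  show "contains_isomorphic_copy TYPE('a) TYPE(ell1)"
  proof (rule contains_ell1_if_lower_bound[OF z])
    show "0 < (3 / 40 :: real)" by simp
    show "3 / 40 * (\<Sum>i<n. \<bar>a i\<bar>) \<le> norm (\<Sum>i<n. a i *\<^sub>R z i)" for a n
      by (rule independent_sequence_lower_bound[OF ind])
  qed
qed

end
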